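(* Let $\Omega\subset\mathbb{C}$ be a bounded simply connected domain. Then $$\rho(\Omega)\leq\frac{\mathrm{Area}(\Omega)^{2}}{2\pi},$$ where $\rho(\Omega)$ is the torsional rigidity of $\Omega$.
   Context: The torsional rigidity is defined through the stress function $u$, the solution of $\Delta u=-2$ in $\Omega$, $u|_{\partial\Omega}=0$ (with $u\in W_0^{1,2}(\Omega)$, the Sobolev space of functions with square-integrable gradients and vanishing boundary values), by $$\sqrt{\rho(\Omega)}=\frac{2\left|\int_\Omega u\,dA\right|}{\|\nabla u\|_{L^2(\Omega)}},$$ equivalently $\rho(\Omega)=2\int_\Omega u\,dA=\int_\Omega|\nabla u|^2\,dA$, where $dA$ is area measure. *)

theory Defs
  imports "HOL-Analysis.Analysis"
begin

primrec continuously_differentiable :: "nat \<Rightarrow> (complex \<Rightarrow> real) \<Rightarrow> bool" where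
  "continuously_differentiable 0 f \<longleftrightarrow> continuous_on UNIV f"
| "continuously_differentiable (Suc k) f \<longleftrightarrow>
     (\<forall>z. f differentiable (at z)) \<and>
     continuously_differentiable k (\<lambda>z. frechet_derivative f (at z) 1) \<and>
     continuously_differentiable k (\<lambda>z. frechet_derivative f (at z) \<i>)"

definition test_function :: "complex set \<Rightarrow> (complex \<Rightarrow> real) \<Rightarrow> bool" where
  "test_function \<Omega> \<phi> \<longleftrightarrow>
     (\<forall>k. continuously_differentiable k \<phi>) \<and>
     compact (closure {z. \<phi> z \<noteq> 0}) \<and> closure {z. \<phi> z \<noteq> 0} \<subseteq> \<Omega>"

text \<open>Planar vector fields are complex-valued functions; the library inner product on
  \<^typ>\<open>complex\<close> is the Euclidean one, so gradients are compared with it directly.\<close>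

definition grad :: "(complex \<Rightarrow> real) \<Rightarrow> complex \<Rightarrow> complex" where
  "grad \<phi> z = Complex (frechet_derivative \<phi> (at z) 1) (frechet_derivative \<phi> (at z) \<i>)"

definition square_integrable :: "complex set \<Rightarrow> (complex \<Rightarrow> 'b::real_normed_vector) \<Rightarrow> bool" where
  "square_integrable \<Omega> f \<longleftrightarrow>
     f \<in> borel_measurable (lebesgue_on \<Omega>) \<and> integrable (lebesgue_on \<Omega>) (\<lambda>z. (norm (f z))\<^sup>2)"

definition L2_norm :: "complex set \<Rightarrow> (complex \<Rightarrow> 'b::real_normed_vector) \<Rightarrow> real" where
  "L2_norm \<Omega> f = sqrt (\<integral>z. (norm (f z))\<^sup>2 \<partial>(lebesgue_on \<Omega>))"

definition weak_gradient :: "complex set \<Rightarrow> (complex \<Rightarrow> real) \<Rightarrow> (complex \<Rightarrow> complex) \<Rightarrow> bool" where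
  "weak_gradient \<Omega> u G \<longleftrightarrow>
     (\<forall>\<phi>. test_function \<Omega> \<phi> \<longrightarrow>
        (\<integral>z. u z *\<^sub>R grad \<phi> z \<partial>(lebesgue_on \<Omega>)) = - (\<integral>z. \<phi> z *\<^sub>R G z \<partial>(lebesgue_on \<Omega>)))"

text \<open>A Sobolev function is carried along with a representative \<open>G\<close> of its weak gradient,
  which is determined only almost everywhere. The space \<open>W\<^sub>0\<^sup>1\<^sup>,\<^sup>2\<close> is the closure of the
  test functions in the norm of \<open>W\<^sup>1\<^sup>,\<^sup>2\<close>.\<close>

definition sobolev_W12 :: "complex set \<Rightarrow> (complex \<Rightarrow> real) \<Rightarrow> (complex \<Rightarrow> complex) \<Rightarrow> bool" where
  "sobolev_W12 \<Omega> u G \<longleftrightarrow>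
     square_integrable \<Omega> u \<and> square_integrable \<Omega> G \<and> weak_gradient \<Omega> u G"

definition sobolev_W12_0 :: "complex set \<Rightarrow> (complex \<Rightarrow> real) \<Rightarrow> (complex \<Rightarrow> complex) \<Rightarrow> bool" where
  "sobolev_W12_0 \<Omega> u G \<longleftrightarrow>
     sobolev_W12 \<Omega> u G \<and>
     (\<exists>\<phi> :: nat \<Rightarrow> complex \<Rightarrow> real.
        (\<forall>n. test_function \<Omega> (\<phi> n)) \<and>
        (\<lambda>n. L2_norm \<Omega> (\<lambda>z. u z - \<phi> n z)) \<longlonglongrightarrow> 0 \<and>
        (\<lambda>n. L2_norm \<Omega> (\<lambda>z. G z - grad (\<phi> n) z)) \<longlonglongrightarrow> 0)"

text \<open>The equation \<open>\<Delta>u = -2\<close> with zero boundary values, in the weak sense appropriate to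
  \<open>W\<^sub>0\<^sup>1\<^sup>,\<^sup>2\<close>: the left-hand integral is \<open>- \<langle>\<Delta>u, \<phi>\<rangle>\<close>.\<close>

definition stress_function :: "complex set \<Rightarrow> (complex \<Rightarrow> real) \<Rightarrow> (complex \<Rightarrow> complex) \<Rightarrow> bool" where
  "stress_function \<Omega> u G \<longleftrightarrow>
     sobolev_W12_0 \<Omega> u G \<and>
     (\<forall>\<phi>. test_function \<Omega> \<phi> \<longrightarrow>
        (\<integral>z. G z \<bullet> grad \<phi> z \<partial>(lebesgue_on \<Omega>)) = 2 * (\<integral>z. \<phi> z \<partial>(lebesgue_on \<Omega>)))"

text \<open>The stress function is unique only up to null sets; the number below does not depend on the
  representatives.\<close>

definition torsional_rigidity :: "complex set \<Rightarrow> real" where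
  "torsional_rigidity \<Omega> =
     (THE \<rho>. \<exists>u G. stress_function \<Omega> u G \<and> 0 \<le> \<rho> \<and>
        sqrt \<rho> = 2 * \<bar>\<integral>z. u z \<partial>(lebesgue_on \<Omega>)\<bar> / L2_norm \<Omega> G)"

end

theory Submission
  imports Defs "HOL-Complex_Analysis.Riemann_Mapping"
begin

text \<open>
  Any vector field \<open>F\<close> with \<open>div F = 1\<close> on \<open>\<Omega>\<close> bounds the torsional rigidity from above:
  \<open>\<integral> \<phi> = - \<integral> F \<bullet> grad \<phi>\<close> for every test function, so the mean of \<open>\<phi>\<close> is at most the \<open>L\<^sup>2\<close> norm of
  \<open>F\<close> times that of \<open>grad \<phi>\<close>. The fields \<open>F = (z - cnj f) / 2\<close> with \<open>f\<close> holomorphic all have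
  divergence \<open>1\<close>, so it suffices that the squared \<open>L\<^sup>2(\<Omega>)\<close> distance of \<open>cnj z\<close> from the holomorphic
  functions is at most \<open>Area(\<Omega>)\<^sup>2 / (2 * pi)\<close>.

  Simple connectedness enters through the Riemann map \<open>g\<close>, which carries this to the unit disc,
  where the function to be approximated is \<open>cnj g * g'\<close>. Dilating \<open>g\<close> and replacing \<open>g'\<close> by a Taylor
  polynomial \<open>p\<close> with primitive \<open>f = (\<Sum>n. a n * z ^ n)\<close>, the distance of \<open>cnj f * p\<close> from the
  holomorphic polynomials is an explicit quadratic form: the error terms of the monomials
  \<open>cnj z ^ n * z ^ m\<close> have an explicit, entrywise nonnegative Gram matrix, and \<open>quadratic_form_bound\<close> estimates
  it by a Schur test. The resulting bound is \<open>pi / 2 * (\<Sum>n. n * \<bar>a n\<bar>\<^sup>2)\<^sup>2\<close>, whose sum, multiplied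
  by \<open>pi\<close>, is the integral of \<open>\<bar>p\<bar>\<^sup>2\<close> over the disc; equality holds for \<open>f = z\<close>, when \<open>\<Omega>\<close> is a disc. This proves
  \<open>test_function_mean_bound\<close>: the mean of a test function is at most
  \<open>Area(\<Omega>) / sqrt (8 * pi)\<close> times the norm of its gradient.

  The torsional rigidity is a definite description over weak solutions, so a solution has to be
  produced before the estimate can be applied to it. The estimate on test functions also makes the
  energy \<open>\<integral> \<bar>grad \<phi>\<bar>\<^sup>2 - 4 * \<integral> \<phi>\<close> bounded below; a minimising sequence is Cauchy by the parallelogram
  law, and completeness of \<open>L\<^sup>2\<close> together with the Poincare inequality gives its limit. Testing
  solutions against each other shows that they all have the same \<open>\<integral> \<bar>G\<bar>\<^sup>2 = 2 * \<integral> u\<close>, which is the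
  rigidity \<open>\<rho>\<close>. Passing to the limit in the estimate gives \<open>\<rho> \<le> 2 * Area(\<Omega>) / sqrt (8 * pi) * sqrt \<rho>\<close>.
\<close>

section \<open>Change of variables under injective holomorphic maps\<close>

text \<open>Determinants, and with them the change of variables theorem, live on \<open>real ^ 'n\<close>. These two mutually
  inverse isometries preserve Lebesgue measure and carry that theorem over to \<^typ>\<open>complex\<close>.\<close>

definition plane :: "real^2 \<Rightarrow> complex" where "plane v = Complex (v$1) (v$2)"
definition plane_inv :: "complex \<Rightarrow> real^2" where "plane_inv z = vector [Re z, Im z]"

lemma plane_inverse [simp]: "plane (plane_inv z) = z" "plane_inv (plane v) = v"
  by (auto simp: plane_def plane_inv_def vec_eq_iff forall_2)

lemma linear_plane: "linear plane" "linear plane_inv"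
  by (auto intro!: linearI simp: plane_def plane_inv_def complex_eq_iff vec_eq_iff forall_2)

lemma plane_image_eq_vimage: "plane_inv ` S = plane -` S" "plane ` T = plane_inv -` T"
  by (auto simp: image_iff) (metis plane_inverse)+

lemma measurable_plane: "plane \<in> borel \<rightarrow>\<^sub>M borel"
  by (intro borel_measurable_continuous_onI linear_continuous_on)
    (use linear_plane linear_conv_bounded_linear in blast)

lemma distr_lborel_plane: "distr lborel borel plane = lborel"
proof (rule lborel_eqI [symmetric])
  fix l u :: complex
  assume le: "\<And>b. b \<in> Basis \<Longrightarrow> l \<bullet> b \<le> u \<bullet> b"
  have "plane -` box l u = box (plane_inv l) (plane_inv u)"
    by (auto simp: box_def plane_def plane_inv_def Basis_complex_def Basis_vec_def forall_2 inner_axis)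
  moreover have "emeasure lborel (box (plane_inv l) (plane_inv u)) = (\<Prod>b\<in>Basis. (plane_inv u - plane_inv l) \<bullet> b)"
  proof (rule emeasure_lborel_box)
    fix b :: "real^2" assume "b \<in> Basis"
    then obtain i where "b = axis i 1" by (auto simp: Basis_vec_def)
    then show "plane_inv l \<bullet> b \<le> plane_inv u \<bullet> b"
      using le[of 1] le[of \<i>] exhaust_2[of i] by (auto simp: plane_inv_def inner_axis Basis_complex_def)
  qed
  moreover have "(\<Prod>b\<in>Basis. (plane_inv u - plane_inv l) \<bullet> b) = (\<Prod>b\<in>Basis. (u - l) \<bullet> b)"
  proof -
    have "(\<Prod>b\<in>(Basis::(real^2) set). (plane_inv u - plane_inv l) \<bullet> b)
        = (\<Prod>i\<in>UNIV. (plane_inv u - plane_inv l) \<bullet> axis (i::2) 1)"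
      unfolding Basis_vec_def by (subst prod.UNION_disjoint) (auto simp: axis_eq_axis)
    also have "\<dots> = (Re u - Re l) * (Im u - Im l)"
      by (simp add: UNIV_2 inner_axis plane_inv_def)
    finally show ?thesis by (simp add: Basis_complex_def)
  qed
  ultimately show "emeasure (distr lborel borel plane) (box l u) = (\<Prod>b\<in>Basis. (u - l) \<bullet> b)"
    using measurable_plane by (simp add: emeasure_distr)
qed simp

lemma measurable_plane_inv: "plane_inv \<in> borel \<rightarrow>\<^sub>M borel"
  by (intro borel_measurable_continuous_onI linear_continuous_on)
    (use linear_plane linear_conv_bounded_linear in blast)

lemma distr_lborel_plane_inv: "distr lborel borel plane_inv = lborel"
proof -
  have "distr lborel borel plane_inv = distr (distr lborel borel plane) borel plane_inv"
    by (simp add: distr_lborel_plane)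
  also have "\<dots> = distr lborel borel (plane_inv \<circ> plane)"
    by (rule distr_distr) (auto intro: measurable_plane measurable_plane_inv)
  also have "\<dots> = lborel" by (simp add: comp_def distr_id2)
  finally show ?thesis .
qed

text \<open>Preserving Lebesgue measure on Borel sets is enough: the null sets then correspond, and so
  does the completion.\<close>

lemma lebesgue_measure_preserving:
  fixes T :: "'a::euclidean_space \<Rightarrow> 'b::euclidean_space"
  assumes T: "T \<in> borel \<rightarrow>\<^sub>M borel" and "distr lborel borel T = lborel"
  shows "T \<in> lebesgue \<rightarrow>\<^sub>M lebesgue" and "distr lebesgue lebesgue T = lebesgue"
proof -
  have m: "T \<in> lborel \<rightarrow>\<^sub>M lborel"
    using T by (simp cong: measurable_cong_sets)
  have eq: "distr lebesgue lborel T = lborel"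
    using assms m by (simp add: distr_completion cong: distr_cong)
  show "T \<in> lebesgue \<rightarrow>\<^sub>M lebesgue"
    using m by (intro completion.measurable_completion2) (auto simp: eq measurable_completion)
  have "lebesgue = completion (distr lebesgue lborel T)"
    by (simp add: eq)
  also have "\<dots> = distr lebesgue lebesgue T"
    using m by (intro completion.completion_distr_eq) (auto simp: eq measurable_completion)
  finally show "distr lebesgue lebesgue T = lebesgue" by simp
qed

lemmas measurable_lebesgue_plane = lebesgue_measure_preserving(1)[OF measurable_plane distr_lborel_plane]
lemmas distr_lebesgue_plane = lebesgue_measure_preserving(2)[OF measurable_plane distr_lborel_plane]
lemmas measurable_lebesgue_plane_inv = lebesgue_measure_preserving(1)[OF measurable_plane_inv distr_lborel_plane_inv]
lemmas distr_lebesgue_plane_inv = lebesgue_measure_preserving(2)[OF measurable_plane_inv distr_lborel_plane_inv]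

lemma integrable_plane:
  fixes f :: "complex \<Rightarrow> 'b::{banach, second_countable_topology}"
  shows "integrable lebesgue (\<lambda>v. f (plane v)) \<longleftrightarrow> integrable lebesgue f" (is "?L = ?R")
    and "(\<integral>v. f (plane v) \<partial>lebesgue) = (\<integral>z. f z \<partial>lebesgue)"
proof -
  have 1: "?R \<Longrightarrow> ?L"
    using integrable_distr[OF measurable_lebesgue_plane, of f] by (simp add: distr_lebesgue_plane)
  moreover have "?L \<Longrightarrow> ?R"
    using integrable_distr[OF measurable_lebesgue_plane_inv, of "\<lambda>v. f (plane v)"]
    by (simp add: distr_lebesgue_plane_inv)
  ultimately show *: "?L = ?R" by blast
  show "(\<integral>v. f (plane v) \<partial>lebesgue) = (\<integral>z. f z \<partial>lebesgue)"
  proof (cases "integrable lebesgue f")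
    case True
    then show ?thesis
      using integral_distr[OF measurable_lebesgue_plane, of f] by (simp add: distr_lebesgue_plane)
  next
    case False
    then show ?thesis using * by (simp add: not_integrable_integral_eq)
  qed
qed

text \<open>Integrability and the value of the integral are coupled in one equivalence so that the change of
  variables theorem, which has the same shape, can be rewritten on both sides.\<close>

lemma lebesgue_on_plane:
  fixes f :: "complex \<Rightarrow> complex"
  assumes S: "S \<in> sets lebesgue"
  shows "(\<lambda>v. plane_inv (f (plane v))) absolutely_integrable_on (plane_inv ` S) \<and>
           integral (plane_inv ` S) (\<lambda>v. plane_inv (f (plane v))) = plane_inv b
     \<longleftrightarrow> integrable (lebesgue_on S) f \<and> (\<integral>z. f z \<partial>lebesgue_on S) = b"
proof -
  have bl: "bounded_linear plane" "bounded_linear plane_inv"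
    using linear_plane linear_conv_bounded_linear by blast+
  have S': "plane_inv ` S \<in> sets lebesgue"
    using measurable_sets[OF measurable_lebesgue_plane S] by (simp add: plane_image_eq_vimage)
  have ind: "indicator (plane_inv ` S) v = (indicator S (plane v) :: real)" for v
    by (auto simp: plane_image_eq_vimage indicator_def)
  have "(\<lambda>v. f (plane v)) absolutely_integrable_on (plane_inv ` S)"
    if "(\<lambda>v. plane_inv (f (plane v))) absolutely_integrable_on (plane_inv ` S)"
    using absolutely_integrable_linear[OF that bl(1)] by (simp add: o_def)
  moreover have "(\<lambda>v. plane_inv (f (plane v))) absolutely_integrable_on (plane_inv ` S)"
    if "(\<lambda>v. f (plane v)) absolutely_integrable_on (plane_inv ` S)"
    using absolutely_integrable_linear[OF that bl(2)] by (simp add: o_def)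
  ultimately have i1: "(\<lambda>v. plane_inv (f (plane v))) absolutely_integrable_on (plane_inv ` S)
      \<longleftrightarrow> (\<lambda>v. f (plane v)) absolutely_integrable_on (plane_inv ` S)"
    by blast
  have i2: "(\<lambda>v. f (plane v)) absolutely_integrable_on (plane_inv ` S) \<longleftrightarrow> integrable (lebesgue_on S) f"
    using integrable_plane(1)[of "\<lambda>z. indicator S z *\<^sub>R f z"] S
    by (simp add: set_integrable_def ind integrable_restrict_space)
  have "integral (plane_inv ` S) (\<lambda>v. plane_inv (f (plane v))) = plane_inv (\<integral>z. f z \<partial>lebesgue_on S)"
    if int: "(\<lambda>v. f (plane v)) absolutely_integrable_on (plane_inv ` S)"
  proof -
    have "integral (plane_inv ` S) (\<lambda>v. plane_inv (f (plane v))) = plane_inv (integral (plane_inv ` S) (\<lambda>v. f (plane v)))"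
      using integral_linear[OF set_lebesgue_integral_eq_integral(1)[OF int] bl(2)] by (simp add: o_def)
    also have "integral (plane_inv ` S) (\<lambda>v. f (plane v)) = (\<integral>v. indicator S (plane v) *\<^sub>R f (plane v) \<partial>lebesgue)"
      using set_lebesgue_integral_eq_integral(2)[OF int] by (simp add: set_lebesgue_integral_def ind)
    also have "\<dots> = (\<integral>z. f z \<partial>lebesgue_on S)"
      using integrable_plane(2)[of "\<lambda>z. indicator S z *\<^sub>R f z"] S by (simp add: integral_restrict_space)
    finally show ?thesis .
  qed
  then show ?thesis using i1 i2 by (metis plane_inverse(1))
qed

text \<open>By the Cauchy--Riemann equations the real Jacobian determinant of a holomorphic map is the
  squared modulus of its complex derivative.\<close>

theorem holomorphic_change_of_variables:
  fixes f g :: "complex \<Rightarrow> complex"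
  assumes S: "S \<in> sets lebesgue" and gS: "g ` S \<in> sets lebesgue"
    and der: "\<And>z. z \<in> S \<Longrightarrow> (g has_field_derivative g' z) (at z within S)"
    and inj: "inj_on g S"
  shows "integrable (lebesgue_on S) (\<lambda>z. (cmod (g' z))\<^sup>2 *\<^sub>R f (g z)) \<and>
           (\<integral>z. (cmod (g' z))\<^sup>2 *\<^sub>R f (g z) \<partial>lebesgue_on S) = b
     \<longleftrightarrow> integrable (lebesgue_on (g ` S)) f \<and> (\<integral>z. f z \<partial>lebesgue_on (g ` S)) = b"
proof -
  let ?S = "plane_inv ` S"
  let ?g = "\<lambda>v. plane_inv (g (plane v))"
  let ?g' = "\<lambda>v w. plane_inv (g' (plane v) * plane w)"
  have bl: "bounded_linear plane" "bounded_linear plane_inv"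
    using linear_plane linear_conv_bounded_linear by blast+
  have S': "?S \<in> sets lebesgue"
    using measurable_sets[OF measurable_lebesgue_plane S] by (simp add: plane_image_eq_vimage)
  have det: "\<bar>det (matrix (?g' v))\<bar> = (cmod (g' (plane v)))\<^sup>2" for v
    by (simp add: det_2 matrix_def plane_inv_def plane_def axis_def cmod_power2 flip: power2_eq_square)
  have der': "(?g has_derivative ?g' v) (at v within ?S)" if "v \<in> ?S" for v
  proof -
    have 1: "(plane has_derivative plane) (at v within ?S)"
      by (rule bounded_linear_imp_has_derivative[OF bl(1)])
    have "plane v \<in> S" using that by auto
    then have 2: "(g has_derivative (*) (g' (plane v))) (at (plane v) within plane ` ?S)"
      using der by (simp add: has_field_derivative_def image_image)
    have "((\<lambda>v. g (plane v)) has_derivative (\<lambda>w. g' (plane v) * plane w)) (at v within ?S)"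
      by (rule has_derivative_in_compose[OF 1 2])
    then show ?thesis by (rule bounded_linear.has_derivative[OF bl(2)])
  qed
  have inj': "inj_on ?g ?S"
    using inj by (auto simp: inj_on_def) (metis plane_inverse)
  have img: "?g ` ?S = plane_inv ` g ` S" by (auto simp: image_iff)
  have "integrable (lebesgue_on S) (\<lambda>z. (cmod (g' z))\<^sup>2 *\<^sub>R f (g z)) \<and>
           (\<integral>z. (cmod (g' z))\<^sup>2 *\<^sub>R f (g z) \<partial>lebesgue_on S) = b
      \<longleftrightarrow> (\<lambda>v. \<bar>det (matrix (?g' v))\<bar> *\<^sub>R plane_inv (f (plane (?g v)))) absolutely_integrable_on ?S \<and>
         integral ?S (\<lambda>v. \<bar>det (matrix (?g' v))\<bar> *\<^sub>R plane_inv (f (plane (?g v)))) = plane_inv b"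
    using lebesgue_on_plane[OF S, of "\<lambda>z. (cmod (g' z))\<^sup>2 *\<^sub>R f (g z)" b]
    unfolding det by (simp add: linear_scale[OF linear_plane(2)])
  also have "\<dots> \<longleftrightarrow> (\<lambda>v. plane_inv (f (plane v))) absolutely_integrable_on (?g ` ?S) \<and>
         integral (?g ` ?S) (\<lambda>v. plane_inv (f (plane v))) = plane_inv b"
    by (rule has_absolute_integral_change_of_variables[OF S' der' inj'])
  also have "\<dots> \<longleftrightarrow> integrable (lebesgue_on (g ` S)) f \<and> (\<integral>z. f z \<partial>lebesgue_on (g ` S)) = b"
    unfolding img by (rule lebesgue_on_plane[OF gS])
  finally show ?thesis .
qed

corollary holomorphic_change_of_variables_real:
  fixes g :: "complex \<Rightarrow> complex" and f :: "complex \<Rightarrow> real"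
  assumes S: "open S" and der: "\<And>z. z \<in> S \<Longrightarrow> (g has_field_derivative g' z) (at z)"
    and inj: "inj_on g S" and f: "integrable (lebesgue_on (g ` S)) f"
  shows "integrable (lebesgue_on S) (\<lambda>z. (cmod (g' z))\<^sup>2 * f (g z))"
    and "(\<integral>z. (cmod (g' z))\<^sup>2 * f (g z) \<partial>lebesgue_on S) = (\<integral>z. f z \<partial>lebesgue_on (g ` S))"
proof -
  have "g holomorphic_on S" using der S holomorphic_on_open by blast
  then have "open (g ` S)" using S inj open_mapping_thm3 by blast
  then have "g ` S \<in> sets lebesgue" "S \<in> sets lebesgue" using S by auto
  moreover have "integrable (lebesgue_on (g ` S)) (\<lambda>z. complex_of_real (f z))"
    using f by simp
  ultimately have *: "integrable (lebesgue_on S) (\<lambda>z. (cmod (g' z))\<^sup>2 *\<^sub>R complex_of_real (f (g z))) \<and>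
           (\<integral>z. (cmod (g' z))\<^sup>2 *\<^sub>R complex_of_real (f (g z)) \<partial>lebesgue_on S) = (\<integral>z. complex_of_real (f z) \<partial>lebesgue_on (g ` S))"
    by (subst holomorphic_change_of_variables[where g=g])
      (use der inj in \<open>auto intro: has_field_derivative_at_within\<close>)
  then have "integrable (lebesgue_on S) (\<lambda>z. complex_of_real ((cmod (g' z))\<^sup>2 * f (g z)))"
    by (simp add: scaleR_conv_of_real)
  then show "integrable (lebesgue_on S) (\<lambda>z. (cmod (g' z))\<^sup>2 * f (g z))"
    using integrable_Re by fastforce
  show "(\<integral>z. (cmod (g' z))\<^sup>2 * f (g z) \<partial>lebesgue_on S) = (\<integral>z. f z \<partial>lebesgue_on (g ` S))"
    using conjunct2[OF *] unfolding scaleR_conv_of_real of_real_mult[symmetric] integral_complex_of_real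
    by simp
qed

section \<open>A Schur test for a Hankel-type quadratic form\<close>

lemma sum_real_upto: "(\<Sum>j=1..n. real j) = real n * (real n + 1) / 2"
  by (induction n) (simp_all add: field_simps)

text \<open>The matrix \<open>min 1 (\<alpha> n * \<alpha> l)\<close> with \<open>\<alpha> n = n / (N + 1 - n)\<close> has \<open>N + 1 - l\<close> as a positive
  generalised eigenvector relative to \<open>diag \<alpha>\<close>, with eigenvalue \<open>(N + 1) / 2\<close>. The minimum switches
  exactly at \<open>n + l = N + 1\<close>, because there both numerator and denominator are the same product, and
  each of the two ranges contributes an arithmetic series.\<close>

lemma schur_row_sum:
  fixes n N :: nat
  assumes "1 \<le> n" "n \<le> N"
  shows "(\<Sum>l=1..N. min 1 (real n * real l / (real (N+1-n) * real (N+1-l))) * real (N+1-l))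
           = real n * (real N + 1) / 2"
proof -
  define K where "K = N + 1 - n"
  have K: "1 \<le> K" "K \<le> N" and Kr: "real K = real N + 1 - real n"
    using assms by (auto simp: K_def of_nat_diff)
  have low: "min 1 (real n * real l / (real K * real (N+1-l))) * real (N+1-l) = real n / real K * real l"
    if "l \<in> {1..K}" for l
  proof -
    have pos: "real (N+1-l) > 0" "real K > 0" using that K by auto
    have "n * l \<le> K * (N+1-l)"
      using that assms by (metis (no_types, opaque_lifting) K_def atLeastAtMost_iff diff_diff_cancel
          diff_le_mono2 le_SucI mult.commute mult_le_mono Suc_eq_plus1)
    then have "real n * real l \<le> real K * real (N+1-l)"
      by (metis of_nat_le_iff of_nat_mult)
    then have "real n * real l / (real K * real (N+1-l)) \<le> 1"
      using pos by (simp add: divide_le_eq)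
    moreover have "real n * real l / (real K * Q) * Q = real n / real K * real l" if "Q > 0" for Q
      using that pos by (simp add: field_simps)
    ultimately show ?thesis using pos by (metis min_absorb2)
  qed
  have high: "min 1 (real n * real l / (real K * real (N+1-l))) * real (N+1-l) = real (N+1-l)"
    if "l \<in> {K+1..N}" for l
  proof -
    have pos: "real (N+1-l) > 0" "real K > 0" using that K by auto
    have "K * (N+1-l) \<le> l * n"
      by (rule mult_le_mono) (use that assms in \<open>auto simp: K_def\<close>)
    then have "real K * real (N+1-l) \<le> real n * real l"
      by (metis of_nat_le_iff of_nat_mult mult.commute)
    then have "1 \<le> real n * real l / (real K * real (N+1-l))"
      using pos by (simp add: le_divide_eq)
    then show ?thesis by (simp add: min_def)
  qed
  have "(\<Sum>l=1..N. min 1 (real n * real l / (real K * real (N+1-l))) * real (N+1-l))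
      = (\<Sum>l\<in>{1..K}\<union>{K+1..N}. min 1 (real n * real l / (real K * real (N+1-l))) * real (N+1-l))"
    using K by (intro sum.cong) auto
  also have "\<dots> = (\<Sum>l=1..K. real n / real K * real l) + (\<Sum>l=K+1..N. real (N+1-l))"
    using low high by (subst sum.union_disjoint) auto
  also have "(\<Sum>l=K+1..N. real (N+1-l)) = (\<Sum>j=1..n-1. real j)"
    by (rule sum.reindex_bij_witness[where i="\<lambda>j. N+1-j" and j="\<lambda>l. N+1-l"])
      (use assms in \<open>auto simp: K_def\<close>)
  also have "(\<Sum>j=1..n-1. real j) = (real n - 1) * real n / 2"
    using sum_real_upto[of "n-1"] assms by (simp add: of_nat_diff)
  also have "(\<Sum>l=1..K. real n / real K * real l) = real n * (real K + 1) / 2"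
    using sum_real_upto[of K] K by (simp only: sum_distrib_left[symmetric]) (simp add: field_simps)
  finally show ?thesis unfolding K_def[symmetric] by (simp add: Kr field_simps)
qed

text \<open>Up to the factor \<open>pi\<close>, this is the Gram matrix in \<open>L\<^sup>2\<close> of the unit disc of the functions
  \<open>cnj z ^ n * z ^ m\<close> after subtraction of their orthogonal projections on the holomorphic functions;
  see \<open>integral_monomial_residue\<close>. The minimum merges the case \<open>n \<le> m\<close>, where the projection is
  nonzero, with the case \<open>n > m\<close>, where the monomial is already orthogonal to the holomorphic functions.\<close>

definition residue_gram :: "nat \<times> nat \<Rightarrow> nat \<times> nat \<Rightarrow> real" where
  "residue_gram p q = (case p of (n,m) \<Rightarrow> case q of (l,k) \<Rightarrow>
     if m + l = n + k then min 1 (real n * real l / ((real m + 1) * (real k + 1))) / (real n + real k + 1) else 0)"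

text \<open>The weight vanishes unless \<open>m + l = n + k\<close>. Sorting the four-fold sum by \<open>m - n\<close>, as orthogonality
  suggests, gives blocks that are not bounded well enough, because they behave like the Hilbert
  matrix. Exchanging \<open>m\<close> and \<open>k\<close> sorts the sum by \<open>N = n + k = l + m\<close> instead, and turns the
  coefficient into a product \<open>Y (n, k) * Y (l, m)\<close> with \<open>Y (n, k) = A n * B k\<close>. In this grouping the
  Schur test with the weights \<open>k + 1 = N + 1 - n\<close> of \<open>schur_row_sum\<close> yields the sharp constant.\<close>

lemma quadratic_form_bound:
  fixes A B :: "nat \<Rightarrow> real"
  assumes A: "\<And>n. 0 \<le> A n" and B: "\<And>n. 0 \<le> B n"
  shows "(\<Sum>(n,m)\<in>{1..L}\<times>{..M}. \<Sum>(l,k)\<in>{1..L}\<times>{..M}. A n * B m * (A l * B k) * residue_gram (n,m) (l,k))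
     \<le> (\<Sum>n=1..L. real n * (A n)\<^sup>2) * (\<Sum>m\<le>M. (B m)\<^sup>2 / (real m + 1)) / 2"
proof -
  let ?I = "{1..L}\<times>{..M}"
  \<comment> \<open>\<open>V\<close> is the weight after the exchange of \<open>m\<close> and \<open>k\<close>; it couples only pairs of equal sum.\<close>
  define V where "V = (\<lambda>(n,k) (l,m). residue_gram (n,m) (l,k))"
  have Vsym: "V p q = V q p" for p q
    by (auto simp: V_def residue_gram_def split: prod.splits) (simp_all add: mult.commute)
  have Vpos: "V p q \<ge> 0" for p q
    by (auto simp: V_def residue_gram_def split: prod.splits)
  define Y where "Y = (\<lambda>(n,k). A n * B k)"
  define c where "c = (\<lambda>(n::nat,k::nat). real k + 1)"
  have cpos: "c p > 0" for p by (auto simp: c_def split: prod.splits)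
  \<comment> \<open>The indices are cut off at \<open>L\<close> and \<open>M\<close>, so a row is only part of the full sum; the omitted terms
    are nonnegative.\<close>
  have row: "(\<Sum>q\<in>?I. V p q * c q) \<le> real (fst p) / 2" if "p \<in> ?I" for p
  proof -
    obtain n k where "p = (n,k)" by (cases p)
    with that have p: "p = (n,k)" "1 \<le> n" by auto
    let ?N = "n + k"
    let ?J = "{q\<in>?I. fst q + snd q = ?N}"
    let ?t = "\<lambda>l. min 1 (real n * real l / (real (?N+1-n) * real (?N+1-l))) * real (?N+1-l)"
    have "(\<Sum>q\<in>?I. V p q * c q) = (\<Sum>q\<in>?J. V p q * c q)"
      by (rule sum.mono_neutral_right) (auto simp: V_def residue_gram_def p split: if_splits)
    also have "\<dots> = (\<Sum>q\<in>?J. ?t (fst q) / (real ?N + 1))"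
    proof (rule sum.cong[OF refl])
      fix q assume "q \<in> ?J"
      then obtain l m where q: "q = (l,m)" "l + m = n + k" by auto
      then have "?N + 1 - l = m + 1" "?N + 1 - n = k + 1" by auto
      then show "V p q * c q = ?t (fst q) / (real ?N + 1)"
        using q by (simp add: V_def residue_gram_def p c_def add.commute mult.commute)
    qed
    also have "\<dots> = (\<Sum>l\<in>fst ` ?J. ?t l / (real ?N + 1))"
      by (subst sum.reindex) (auto simp: inj_on_def)
    also have "\<dots> \<le> (\<Sum>l\<in>{1..?N}. ?t l / (real ?N + 1))"
      by (rule sum_mono2) auto
    also have "\<dots> = (\<Sum>l\<in>{1..?N}. ?t l) / (real ?N + 1)"
      by (simp add: sum_divide_distrib)
    also have "\<dots> = real n / 2"
      using schur_row_sum[of n ?N] p by (simp add: field_simps)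
    finally show ?thesis by (simp add: p)
  qed
  have "(\<Sum>(n,m)\<in>?I. \<Sum>(l,k)\<in>?I. A n * B m * (A l * B k) * residue_gram (n,m) (l,k))
      = (\<Sum>n=1..L. \<Sum>m\<le>M. \<Sum>l=1..L. \<Sum>k\<le>M. A n * B m * (A l * B k) * residue_gram (n,m) (l,k))"
    by (simp only: sum.cartesian_product' prod.case)
  also have "\<dots> = (\<Sum>n=1..L. \<Sum>l=1..L. \<Sum>m\<le>M. \<Sum>k\<le>M. A n * B m * (A l * B k) * residue_gram (n,m) (l,k))"
    by (rule sum.cong[OF refl], rule sum.swap)
  also have "\<dots> = (\<Sum>n=1..L. \<Sum>l=1..L. \<Sum>k\<le>M. \<Sum>m\<le>M. A n * B m * (A l * B k) * residue_gram (n,m) (l,k))"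
    by (rule sum.cong[OF refl], rule sum.cong[OF refl], rule sum.swap)
  also have "\<dots> = (\<Sum>n=1..L. \<Sum>k\<le>M. \<Sum>l=1..L. \<Sum>m\<le>M. A n * B m * (A l * B k) * residue_gram (n,m) (l,k))"
    by (rule sum.cong[OF refl], rule sum.swap)
  also have "\<dots> = (\<Sum>p\<in>?I. \<Sum>q\<in>?I. Y p * Y q * V p q)"
    by (simp only: sum.cartesian_product' prod.case Y_def V_def mult_ac)
  also have "\<dots> \<le> (\<Sum>p\<in>?I. \<Sum>q\<in>?I. ((Y p)\<^sup>2 / c p * (V p q * c q) + (Y q)\<^sup>2 / c q * (V q p * c p)) / 2)"
  proof (intro sum_mono)
    fix p q
    have "0 \<le> (Y p * c q - Y q * c p)\<^sup>2 / (2 * c p * c q)" using cpos[of p] cpos[of q] by simp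
    also have "\<dots> = ((Y p)\<^sup>2 / c p * c q + (Y q)\<^sup>2 / c q * c p) / 2 - Y p * Y q"
      using cpos[of p] cpos[of q] by (simp add: field_simps power2_eq_square)
    finally have "Y p * Y q \<le> ((Y p)\<^sup>2 / c p * c q + (Y q)\<^sup>2 / c q * c p) / 2" by simp
    then have "Y p * Y q * V p q \<le> ((Y p)\<^sup>2 / c p * c q + (Y q)\<^sup>2 / c q * c p) / 2 * V p q"
      using Vpos by (rule mult_right_mono)
    then show "Y p * Y q * V p q \<le> ((Y p)\<^sup>2 / c p * (V p q * c q) + (Y q)\<^sup>2 / c q * (V q p * c p)) / 2"
      using Vsym[of p q] by (simp add: algebra_simps add_divide_distrib)
  qed
  also have "\<dots> = (\<Sum>p\<in>?I. \<Sum>q\<in>?I. (Y p)\<^sup>2 / c p * (V p q * c q)) / 2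
      + (\<Sum>p\<in>?I. \<Sum>q\<in>?I. (Y q)\<^sup>2 / c q * (V q p * c p)) / 2"
    by (simp add: sum.distrib add_divide_distrib sum_divide_distrib)
  also have "(\<Sum>p\<in>?I. \<Sum>q\<in>?I. (Y q)\<^sup>2 / c q * (V q p * c p)) = (\<Sum>p\<in>?I. \<Sum>q\<in>?I. (Y p)\<^sup>2 / c p * (V p q * c q))"
    by (rule sum.swap)
  also have "(\<Sum>p\<in>?I. \<Sum>q\<in>?I. (Y p)\<^sup>2 / c p * (V p q * c q)) / 2 + (\<Sum>p\<in>?I. \<Sum>q\<in>?I. (Y p)\<^sup>2 / c p * (V p q * c q)) / 2
      = (\<Sum>p\<in>?I. (Y p)\<^sup>2 / c p * (\<Sum>q\<in>?I. V p q * c q))"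
    by (simp add: sum_distrib_left)
  also have "\<dots> \<le> (\<Sum>p\<in>?I. (Y p)\<^sup>2 / c p * (real (fst p) / 2))"
    using cpos row by (intro sum_mono mult_left_mono) (auto simp: less_imp_le)
  also have "\<dots> = (\<Sum>n=1..L. real n * (A n)\<^sup>2) * (\<Sum>m\<le>M. (B m)\<^sup>2 / (real m + 1)) / 2"
    by (simp add: sum_product sum.cartesian_product sum_divide_distrib Y_def c_def case_prod_unfold power_mult_distrib mult_ac)
  finally show ?thesis .
qed

section \<open>Distance from the holomorphic functions on the disc\<close>

lemma integrable_on_subset_of_compact:
  fixes f :: "'a::euclidean_space \<Rightarrow> 'b::euclidean_space"
  assumes "compact K" "continuous_on K f" "S \<subseteq> K" "S \<in> sets lebesgue"
  shows "integrable (lebesgue_on S) f"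
proof -
  have "integrable lborel (\<lambda>x. indicator K x *\<^sub>R f x)"
    by (rule borel_integrable_compact) (use assms in auto)
  then have "f absolutely_integrable_on K"
    by (simp add: set_integrable_def integrable_completion)
  then have "f absolutely_integrable_on S"
    by (rule set_integrable_subset) (use assms in auto)
  then show ?thesis
    using assms by (simp add: set_integrable_def integrable_restrict_space)
qed

abbreviation disc :: "complex measure" where "disc \<equiv> lebesgue_on (ball 0 1)"

lemma integrable_disc:
  fixes f :: "complex \<Rightarrow> 'b::euclidean_space"
  shows "continuous_on UNIV f \<Longrightarrow> integrable disc f"
  by (rule integrable_on_subset_of_compact[of "cball 0 1"]) (auto intro: continuous_on_subset)

lemma integral_ball_scale:
  fixes f :: "complex \<Rightarrow> complex"
  assumes f: "continuous_on UNIV f" and c: "c \<noteq> 0"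
  shows "(\<integral>z. f z \<partial>lebesgue_on (ball 0 (cmod c))) = (cmod c)\<^sup>2 *\<^sub>R (\<integral>z. f (c * z) \<partial>disc)"
proof -
  have img: "(*) c ` ball 0 1 = ball 0 (cmod c)"
    using c by (auto simp: norm_mult image_iff intro!: bexI[of _ "x / c" for x] simp: norm_divide divide_simps)
  have "integrable (lebesgue_on (ball 0 (cmod c))) f"
    by (rule integrable_on_subset_of_compact[of "cball 0 (cmod c)"]) (auto intro: continuous_on_subset[OF f])
  then have "(\<integral>z. (cmod c)\<^sup>2 *\<^sub>R f (c * z) \<partial>disc) = (\<integral>z. f z \<partial>lebesgue_on (ball 0 (cmod c)))"
    using holomorphic_change_of_variables[of "ball 0 1" "(*) c" "\<lambda>_. c" f] c
    by (auto simp: img inj_on_def intro!: derivative_eq_intros)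
  then show ?thesis by simp
qed

text \<open>Rotating the disc by the angle \<open>pi / (p - q)\<close> changes the sign of the integrand.\<close>

lemma moment_orthogonal:
  assumes "p \<noteq> q"
  shows "(\<integral>z. z ^ p * cnj z ^ q \<partial>disc) = 0"
proof -
  define t where "t = pi / (real p - real q)"
  have "cis t ^ p * cnj (cis t) ^ q = cis (real p * t) * cis (- (real q * t))"
    by (simp only: Complex.DeMoivre cis_cnj mult_minus_right)
  also have "\<dots> = cis ((real p - real q) * t)" by (simp add: cis_mult algebra_simps)
  also have "\<dots> = -1" using assms by (simp add: t_def)
  finally have eq: "(cis t * z) ^ p * cnj (cis t * z) ^ q = - (z ^ p * cnj z ^ q)" for z
    by (simp add: power_mult_distrib) (metis (no_types, opaque_lifting) mult.assoc mult.commute mult_minus1)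
  have "(\<integral>z. z ^ p * cnj z ^ q \<partial>disc) = - (\<integral>z. z ^ p * cnj z ^ q \<partial>disc)"
    using integral_ball_scale[of "\<lambda>z. z ^ p * cnj z ^ q" "cis t"]
    by (simp add: eq continuous_intros del: complex_cnj_mult)
  then show ?thesis by (simp add: eq_neg_iff_add_eq_0)
qed

text \<open>With \<open>h\<close> the integral, dilation gives \<open>t ^ (2 * a + 2) * h\<close> for the disc of radius \<open>t\<close>. On the
  annulus between the radii \<open>t\<close> and \<open>1\<close> the integrand lies between \<open>t ^ (2 * a)\<close> and \<open>1\<close>, which
  determines \<open>h\<close> as \<open>t\<close> tends to \<open>1\<close>.\<close>

lemma moment_radial: "(\<integral>z. (cmod z) ^ (2 * a) \<partial>disc) = pi / (real a + 1)"
proof -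
  define h where "h = (\<integral>z. (cmod z) ^ (2 * a) \<partial>disc)"
  have int: "integrable disc (\<lambda>z. (cmod z) ^ k)" for k
    by (intro integrable_disc continuous_intros)
  have area: "(\<integral>z. 1 \<partial>lebesgue_on (ball (0::complex) t)) = pi * t\<^sup>2" if "t > 0" for t :: real
    using that by (simp add: content_ball unit_ball_vol_2 measure_restrict_space)
  have scale: "(\<integral>z. (cmod z) ^ (2*a) \<partial>lebesgue_on (ball 0 t)) = t ^ (2*a+2) * h" if "t > 0" for t
  proof -
    have "complex_of_real (\<integral>z. (cmod z) ^ (2*a) \<partial>lebesgue_on (ball 0 t))
        = (\<integral>z. complex_of_real ((cmod z) ^ (2*a)) \<partial>lebesgue_on (ball 0 (cmod (complex_of_real t))))"
      using that by (simp only: integral_complex_of_real norm_of_real abs_of_pos)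
    also have "\<dots> = t\<^sup>2 *\<^sub>R (\<integral>z. complex_of_real (cmod (of_real t * z) ^ (2*a)) \<partial>disc)"
      by (subst integral_ball_scale) (use that in \<open>auto intro!: continuous_intros\<close>)
    also have "\<dots> = t\<^sup>2 *\<^sub>R complex_of_real (\<integral>z. t ^ (2*a) * cmod z ^ (2*a) \<partial>disc)"
      using that by (simp only: integral_complex_of_real norm_mult norm_of_real abs_of_pos power_mult_distrib)
    also have "\<dots> = complex_of_real (t ^ (2*a+2) * h)"
      by (simp add: h_def scaleR_conv_of_real power_add power2_eq_square mult_ac)
    finally show ?thesis by (simp only: of_real_eq_iff)
  qed
  have split: "(\<integral>z. f z \<partial>disc) - (\<integral>z. f z \<partial>lebesgue_on (ball 0 t)) = (\<integral>z. indicator (- ball 0 t) z * f z \<partial>disc)"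
    if "0 < t" "t < 1" "continuous_on UNIV f" for t and f :: "complex \<Rightarrow> real"
  proof -
    have "(\<integral>z. f z \<partial>lebesgue_on (ball 0 t)) = (\<integral>z. indicator (ball 0 t) z * f z \<partial>disc)"
      using that by (simp add: integral_restrict_space mult.assoc flip: indicator_inter_arith)
        (auto intro!: Bochner_Integration.integral_cong simp: indicator_def)
    moreover have "integrable disc f" using that integrable_disc by blast
    moreover have "integrable disc (\<lambda>z. indicator (ball 0 t) z * f z)"
      using integrable_mult_indicator[OF _ \<open>integrable disc f\<close>, of "ball 0 t"] that
      by (simp add: sets_restrict_space_iff subset_ball)
    ultimately have "(\<integral>z. f z \<partial>disc) - (\<integral>z. f z \<partial>lebesgue_on (ball 0 t))
        = (\<integral>z. f z - indicator (ball 0 t) z * f z \<partial>disc)"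
      by (simp only: Bochner_Integration.integral_diff)
    also have "\<dots> = (\<integral>z. indicator (- ball 0 t) z * f z \<partial>disc)"
      by (rule Bochner_Integration.integral_cong) (auto simp: indicator_def)
    finally show ?thesis .
  qed
  \<comment> \<open>Here \<open>s\<close> is the square of the radius. The area of the annulus and the integral over it share the
    factor \<open>1 - s\<close>, which cancels before the limit is taken.\<close>
  have bounds: "h * (\<Sum>i<Suc a. s ^ i) \<le> pi \<and> s ^ a * pi \<le> h * (\<Sum>i<Suc a. s ^ i)" if s: "0 < s" "s < 1" for s
  proof -
    define t where "t = sqrt s"
    have t: "0 < t" "t < 1" "t\<^sup>2 = s" using s by (auto simp: t_def)
    have ind: "integrable disc (\<lambda>z. indicator (- ball 0 t) z * (cmod z) ^ k)" for k
    proof -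
      have "indicator (- ball 0 t) z * (cmod z) ^ k = (cmod z) ^ k - indicator (ball 0 t) z *\<^sub>R (cmod z) ^ k" for z
        by (auto simp: indicator_def)
      moreover have "ball 0 t \<in> sets disc"
        using t by (simp add: sets_restrict_space_iff subset_ball)
      ultimately show ?thesis using int[of k] by (simp add: integrable_mult_indicator del: real_scaleR_def)
    qed
    have "t ^ (2*a+2) = s ^ Suc a"
      using t(3) by (metis power_mult mult_Suc_right add.commute)
    then have L: "(\<integral>z. indicator (- ball 0 t) z * (cmod z) ^ (2*a) \<partial>disc) = (1 - s ^ Suc a) * h"
      using split[of t "\<lambda>z. (cmod z) ^ (2*a)"] t scale[of t] by (simp add: continuous_intros h_def algebra_simps)
    have R: "(\<integral>z. indicator (- ball 0 t) z \<partial>disc) = (1 - s) * pi"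
      using split[of t "\<lambda>z. 1"] t area[of t] area[of 1] by (simp add: algebra_simps)
    have "(\<integral>z. indicator (- ball 0 t) z * (cmod z) ^ (2*a) \<partial>disc) \<le> (\<integral>z. indicator (- ball 0 t) z \<partial>disc)"
      using ind[of "2*a"] ind[of 0] by (intro integral_mono) (auto simp: indicator_def power_le_one)
    moreover have "(\<integral>z. s ^ a * indicator (- ball 0 t) z \<partial>disc) \<le> (\<integral>z. indicator (- ball 0 t) z * (cmod z) ^ (2*a) \<partial>disc)"
      using ind[of "2*a"] ind[of 0] t
      by (intro integral_mono) (auto simp: indicator_def power_mult intro!: power_mono simp flip: t(3))
    moreover have "1 - s ^ Suc a = (1 - s) * (\<Sum>i<Suc a. s ^ i)"
      by (rule one_diff_power_eq)
    ultimately have "(1 - s) * (h * (\<Sum>i<Suc a. s ^ i)) \<le> (1 - s) * pi"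
       "(1 - s) * (s ^ a * pi) \<le> (1 - s) * (h * (\<Sum>i<Suc a. s ^ i))"
      unfolding L R integral_mult_right_zero by (simp_all only: mult_ac)
    then show ?thesis using s by simp
  qed
  have ev: "eventually (\<lambda>s. 0 < s \<and> s < (1::real)) (at_left 1)"
    using eventually_at_left_real[of 0 1] by (auto elim: eventually_mono)
  have lim1: "((\<lambda>s. h * (\<Sum>i<Suc a. s ^ i)) \<longlongrightarrow> h * (\<Sum>i<Suc a. 1 ^ i)) (at_left 1)"
    by (intro tendsto_intros)
  have lim2: "((\<lambda>s. s ^ a * pi) \<longlongrightarrow> 1 ^ a * pi) (at_left 1)"
    by (intro tendsto_intros)
  have "h * (\<Sum>i<Suc a. 1 ^ i) \<le> pi"
    by (rule tendsto_upperbound[OF lim1]) (use ev bounds in \<open>auto elim!: eventually_mono\<close>)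
  moreover have "1 ^ a * pi \<le> h * (\<Sum>i<Suc a. 1 ^ i)"
    by (rule tendsto_le[OF _ lim1 lim2]) (use ev bounds in \<open>auto elim!: eventually_mono\<close>)
  ultimately have "h * (real a + 1) = pi" by (simp add: algebra_simps)
  then show ?thesis by (simp add: h_def field_simps)
qed

lemma moment:
  "(\<integral>z. z ^ p * cnj z ^ q \<partial>disc) = (if p = q then of_real (pi / (real p + 1)) else 0)"
proof (cases "p = q")
  case True
  have "z ^ p * cnj z ^ p = complex_of_real (cmod z ^ (2 * p))" for z
    by (subst power_mult, subst of_real_power, subst complex_norm_square) (simp add: power_mult_distrib)
  then have "(\<integral>z. z ^ p * cnj z ^ p \<partial>disc) = (\<integral>z. complex_of_real (cmod z ^ (2 * p)) \<partial>disc)"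
    by (simp only:)
  also have "\<dots> = complex_of_real (pi / (real p + 1))"
    by (simp only: integral_complex_of_real moment_radial)
  finally show ?thesis using True by (simp only: refl if_True)
qed (simp add: moment_orthogonal)

text \<open>The subtracted multiple of \<open>z ^ (m - n)\<close> is the orthogonal projection of \<open>cnj z ^ n * z ^ m\<close> on the
  holomorphic functions in \<open>L\<^sup>2\<close> of the unit disc.\<close>

definition monomial_residue :: "nat \<times> nat \<Rightarrow> complex \<Rightarrow> complex" where
  "monomial_residue = (\<lambda>(n,m) z. cnj z ^ n * z ^ m
     - of_real (if n \<le> m then (real m - real n + 1) / (real m + 1) else 0) * z ^ (m - n))"

lemma integral_monomial_residue:
  "(\<integral>z. monomial_residue p z * cnj (monomial_residue q z) \<partial>disc) = of_real (pi * residue_gram p q)"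
proof -
  obtain n m l k where pq: "p = (n,m)" "q = (l,k)" by (cases p, cases q)
  define \<alpha> where "\<alpha> = (if n \<le> m then (real m - real n + 1) / (real m + 1) else 0)"
  define \<beta> where "\<beta> = (if l \<le> k then (real k - real l + 1) / (real k + 1) else 0)"
  have mono: "integrable disc (\<lambda>z. c * (z ^ i * cnj z ^ j))" for c i j
    by (intro integrable_disc continuous_intros)
  have \<alpha>: "monomial_residue p z = cnj z ^ n * z ^ m - of_real \<alpha> * z ^ (m - n)" for z
    by (simp add: monomial_residue_def pq \<alpha>_def)
  have \<beta>: "monomial_residue q z = cnj z ^ l * z ^ k - of_real \<beta> * z ^ (k - l)" for z
    by (simp add: monomial_residue_def pq \<beta>_def)
  have expand: "monomial_residue p z * cnj (monomial_residue q z)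
     = z ^ (m + l) * cnj z ^ (n + k) - of_real \<alpha> * (z ^ (m - n + l) * cnj z ^ k)
       - of_real \<beta> * (z ^ m * cnj z ^ (n + (k - l)))
       + of_real (\<alpha> * \<beta>) * (z ^ (m - n) * cnj z ^ (k - l))" for z
    unfolding \<alpha> \<beta> by (simp add: power_add algebra_simps)
  have "(\<integral>z. monomial_residue p z * cnj (monomial_residue q z) \<partial>disc)
     = (\<integral>z. z ^ (m + l) * cnj z ^ (n + k) \<partial>disc) - of_real \<alpha> * (\<integral>z. z ^ (m - n + l) * cnj z ^ k \<partial>disc)
       - of_real \<beta> * (\<integral>z. z ^ m * cnj z ^ (n + (k - l)) \<partial>disc)
       + of_real (\<alpha> * \<beta>) * (\<integral>z. z ^ (m - n) * cnj z ^ (k - l) \<partial>disc)"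
    unfolding expand
    using mono[of 1] mono
    by (simp only: Bochner_Integration.integral_add Bochner_Integration.integral_diff
      Bochner_Integration.integrable_diff integral_mult_right_zero mult_1 simp_thms)
  also have "\<dots> = of_real (pi * residue_gram p q)"
  proof (cases "m + l = n + k")
    case False
    have "\<alpha> = 0 \<or> m - n + l \<noteq> k" "\<beta> = 0 \<or> m \<noteq> n + (k - l)" "\<alpha> = 0 \<or> \<beta> = 0 \<or> m - n \<noteq> k - l"
      using False by (auto simp: \<alpha>_def \<beta>_def)
    then show ?thesis using False by (auto simp: moment residue_gram_def pq)
  next
    case True
    show ?thesis
    proof (cases "n \<le> m")
      case True2: True
      define d where "d = m - n"
      have d: "m = n + d" "k = l + d" using True True2 by (auto simp: d_def)
      have "real n * real l \<le> (real m + 1) * (real k + 1)"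
        by (rule mult_mono) (auto simp: d)
      then have "residue_gram p q = real n * real l / ((real m + 1) * (real k + 1)) / (real n + real k + 1)"
        by (simp add: residue_gram_def pq True min_def divide_le_eq)
      also have "\<dots> = 1 / (real n + real l + real d + 1) - (real d + 1) / ((real m + 1) * (real k + 1))"
      proof -
        have "real n + real l + real d + 1 > 0" "real n + real d + 1 > 0" "real l + real d + 1 > 0" by auto
        then show ?thesis unfolding d of_nat_add by (simp add: divide_simps) (simp add: algebra_simps)
      qed
      finally have W: "residue_gram p q = 1 / (real n + real l + real d + 1) - (real d + 1) / ((real m + 1) * (real k + 1))" .
      have ab: "\<alpha> = (real d + 1) / (real m + 1)" "\<beta> = (real d + 1) / (real k + 1)"
        by (auto simp: \<alpha>_def \<beta>_def d)
      have "pi / (real n + real l + real d + 1) - \<alpha> * (pi / (real k + 1)) - \<beta> * (pi / (real m + 1))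
         + \<alpha> * \<beta> * (pi / (real d + 1)) = pi * residue_gram p q"
        unfolding W ab by (simp add: divide_simps) (simp add: algebra_simps)
      moreover have "m + l = n + k" "m - n + l = k" "m = n + (k - l)" "m - n = d" "k - l = d"
        "real (n+k) + 1 = real n + real l + real d + 1" using d by auto
      ultimately show ?thesis by (simp only: moment refl if_True flip: of_real_mult of_real_diff of_real_add)
    next
      case False
      then have "m + 1 \<le> n" "k + 1 \<le> l" using True by auto
      then have "(real m + 1) * (real k + 1) \<le> real n * real l"
        by (intro mult_mono) auto
      then have "residue_gram p q = 1 / (real n + real k + 1)"
        by (simp add: residue_gram_def pq True min_def le_divide_eq add_pos_nonneg)
      moreover have "\<alpha> = 0" "\<beta> = 0" using False True by (auto simp: \<alpha>_def \<beta>_def)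
      ultimately show ?thesis using True by (simp add: moment)
    qed
  qed
  finally show ?thesis .
qed

text \<open>The function \<open>P\<close> is the orthogonal projection of \<open>cnj f * h\<close> on the holomorphic functions, so the
  remainder is a combination of \<open>monomial_residue\<close>s. Since the entries of their Gram matrix are nonnegative, the
  coefficients may be replaced by their absolute values, and \<open>quadratic_form_bound\<close> applies.\<close>

lemma polynomial_projection_bound:
  fixes a b :: "nat \<Rightarrow> complex" and L M :: nat
  defines "f \<equiv> \<lambda>z. \<Sum>n=1..L. a n * z ^ n" and "h \<equiv> \<lambda>z. \<Sum>m\<le>M. b m * z ^ m"
  shows "\<exists>P. P holomorphic_on UNIV \<and> (\<integral>z. (cmod (cnj (f z) * h z - P z))\<^sup>2 \<partial>disc)
     \<le> pi / 2 * (\<Sum>n=1..L. real n * (cmod (a n))\<^sup>2) * (\<Sum>m\<le>M. (cmod (b m))\<^sup>2 / (real m + 1))"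
proof (intro exI conjI)
  let ?I = "{1..L} \<times> {..M}"
  define c where "c = (\<lambda>(n,m). cnj (a n) * b m)"
  define P where "P z = (\<Sum>p\<in>?I. c p * (of_real (if fst p \<le> snd p then
     (real (snd p) - real (fst p) + 1) / (real (snd p) + 1) else 0) * z ^ (snd p - fst p)))" for z
  show "P holomorphic_on UNIV"
    unfolding P_def by (intro holomorphic_intros)
  define E where "E z = (\<Sum>p\<in>?I. c p * monomial_residue p z)" for z
  have E: "cnj (f z) * h z - P z = E z" for z
  proof -
    have "cnj (f z) * h z = (\<Sum>p\<in>?I. c p * (cnj z ^ fst p * z ^ snd p))"
      unfolding f_def h_def c_def cnj_sum sum_product sum.cartesian_product
      by (simp add: case_prod_unfold mult_ac)
    then show ?thesis
      unfolding P_def E_def monomial_residue_def sum_subtractf[symmetric]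
      by (simp only: case_prod_unfold right_diff_distrib sum_subtractf)
  qed
  have cont: "continuous_on UNIV (monomial_residue p)" for p
    unfolding monomial_residue_def case_prod_unfold by (intro continuous_intros)
  have int: "integrable disc (\<lambda>z. c p * monomial_residue p z * cnj (c q * monomial_residue q z))" for p q
    by (intro integrable_disc continuous_intros cont)
  have "complex_of_real (\<integral>z. (cmod (E z))\<^sup>2 \<partial>disc) = (\<integral>z. E z * cnj (E z) \<partial>disc)"
    by (simp only: integral_complex_of_real[symmetric] complex_norm_square)
  also have "\<dots> = (\<integral>z. (\<Sum>p\<in>?I. \<Sum>q\<in>?I. c p * monomial_residue p z * cnj (c q * monomial_residue q z)) \<partial>disc)"
    unfolding E_def cnj_sum sum_product ..
  also have "\<dots> = (\<Sum>p\<in>?I. \<Sum>q\<in>?I. (\<integral>z. c p * monomial_residue p z * cnj (c q * monomial_residue q z) \<partial>disc))"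
    using int by (subst Bochner_Integration.integral_sum; (intro Bochner_Integration.integrable_sum)?; simp?)
  also have "\<dots> = (\<Sum>p\<in>?I. \<Sum>q\<in>?I. c p * cnj (c q) * of_real (pi * residue_gram p q))"
  proof (intro sum.cong refl)
    fix p q
    have "(\<integral>z. c p * monomial_residue p z * cnj (c q * monomial_residue q z) \<partial>disc)
        = (\<integral>z. c p * cnj (c q) * (monomial_residue p z * cnj (monomial_residue q z)) \<partial>disc)"
      by (simp add: mult_ac)
    then show "(\<integral>z. c p * monomial_residue p z * cnj (c q * monomial_residue q z) \<partial>disc) = c p * cnj (c q) * of_real (pi * residue_gram p q)"
      by (simp only: integral_mult_right_zero integral_monomial_residue)
  qed
  finally have eq: "complex_of_real (\<integral>z. (cmod (E z))\<^sup>2 \<partial>disc) = (\<Sum>p\<in>?I. \<Sum>q\<in>?I. c p * cnj (c q) * of_real (pi * residue_gram p q))" .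
  have "(\<integral>z. (cmod (E z))\<^sup>2 \<partial>disc) = cmod (complex_of_real (\<integral>z. (cmod (E z))\<^sup>2 \<partial>disc))"
    by simp
  also have "\<dots> = cmod (\<Sum>p\<in>?I. \<Sum>q\<in>?I. c p * cnj (c q) * of_real (pi * residue_gram p q))"
    by (simp only: eq)
  also have "\<dots> \<le> (\<Sum>p\<in>?I. \<Sum>q\<in>?I. cmod (c p) * cmod (c q) * (pi * residue_gram p q))"
  proof -
    have "residue_gram p q \<ge> 0" for p q by (auto simp: residue_gram_def split: prod.splits)
    then have "cmod (c p * cnj (c q) * of_real (pi * residue_gram p q)) = cmod (c p) * cmod (c q) * (pi * residue_gram p q)" for p q
      by (simp add: norm_mult)
    then show ?thesis by (intro order_trans[OF norm_sum] sum_mono) simp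
  qed
  also have "\<dots> = pi * (\<Sum>(n,m)\<in>?I. \<Sum>(l,k)\<in>?I. cmod (a n) * cmod (b m) * (cmod (a l) * cmod (b k)) * residue_gram (n,m) (l,k))"
    by (simp add: c_def case_prod_unfold norm_mult sum_distrib_left mult_ac)
  also have "\<dots> \<le> pi * ((\<Sum>n=1..L. real n * (cmod (a n))\<^sup>2) * (\<Sum>m\<le>M. (cmod (b m))\<^sup>2 / (real m + 1)) / 2)"
    by (intro mult_left_mono quadratic_form_bound) auto
  finally show "(\<integral>z. (cmod (cnj (f z) * h z - P z))\<^sup>2 \<partial>disc)
     \<le> pi / 2 * (\<Sum>n=1..L. real n * (cmod (a n))\<^sup>2) * (\<Sum>m\<le>M. (cmod (b m))\<^sup>2 / (real m + 1))"
    by (simp add: E)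
qed

lemma integral_polynomial_square:
  "(\<integral>z. (cmod (\<Sum>m\<le>M. b m * z ^ m))\<^sup>2 \<partial>disc) = pi * (\<Sum>m\<le>M. (cmod (b m))\<^sup>2 / (real m + 1))"
proof -
  have int: "integrable disc (\<lambda>z. b m * z ^ m * cnj (b k * z ^ k))" for m k
    by (intro integrable_disc continuous_intros)
  have "complex_of_real (\<integral>z. (cmod (\<Sum>m\<le>M. b m * z ^ m))\<^sup>2 \<partial>disc)
      = (\<integral>z. (\<Sum>m\<le>M. b m * z ^ m) * cnj (\<Sum>m\<le>M. b m * z ^ m) \<partial>disc)"
    by (simp only: integral_complex_of_real[symmetric] complex_norm_square)
  also have "\<dots> = (\<integral>z. (\<Sum>m\<le>M. \<Sum>k\<le>M. b m * z ^ m * cnj (b k * z ^ k)) \<partial>disc)"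
    unfolding cnj_sum sum_product ..
  also have "\<dots> = (\<Sum>m\<le>M. \<Sum>k\<le>M. (\<integral>z. b m * z ^ m * cnj (b k * z ^ k) \<partial>disc))"
    using int by (subst Bochner_Integration.integral_sum; (intro Bochner_Integration.integrable_sum)?; simp?)
  also have "\<dots> = (\<Sum>m\<le>M. \<Sum>k\<le>M. if m = k then of_real (pi * ((cmod (b m))\<^sup>2 / (real m + 1))) else 0)"
  proof (intro sum.cong refl)
    fix m k
    have "(\<integral>z. b m * z ^ m * cnj (b k * z ^ k) \<partial>disc) = (\<integral>z. b m * cnj (b k) * (z ^ m * cnj z ^ k) \<partial>disc)"
      by (simp add: mult_ac)
    also have "\<dots> = b m * cnj (b k) * (if m = k then of_real (pi / (real m + 1)) else 0)"
      by (simp only: integral_mult_right_zero moment)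
    also have "\<dots> = (if m = k then of_real (pi * ((cmod (b m))\<^sup>2 / (real m + 1))) else 0)"
      by (simp flip: complex_norm_square)
    finally show "(\<integral>z. b m * z ^ m * cnj (b k * z ^ k) \<partial>disc)
        = (if m = k then of_real (pi * ((cmod (b m))\<^sup>2 / (real m + 1))) else 0)" .
  qed
  also have "\<dots> = complex_of_real (pi * (\<Sum>m\<le>M. (cmod (b m))\<^sup>2 / (real m + 1)))"
    by (simp add: sum_distrib_left)
  finally show ?thesis by (simp only: of_real_eq_iff)
qed

section \<open>Integrals of directional derivatives\<close>

lemma derivative_eq_0_outside_support:
  assumes der: "(\<psi> has_derivative \<psi>') (at z)" and "closed K" "\<And>z. z \<notin> K \<Longrightarrow> \<psi> z = 0" "z \<notin> K"
  shows "\<psi>' = (\<lambda>_. 0)"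
proof -
  have "((\<lambda>_. 0) has_derivative \<psi>') (at z)"
    by (rule has_derivative_transform_within_open[OF der, where s="- K"]) (use assms in auto)
  then show ?thesis using has_derivative_unique has_derivative_const by metis
qed

text \<open>The integral of \<open>\<psi> (z + t *\<^sub>R e)\<close> does not depend on \<open>t\<close> by translation invariance of Lebesgue
  measure; its difference quotients converge dominatedly, by the mean value theorem and the compact
  support.\<close>

lemma integral_directional_derivative_eq_0:
  fixes \<psi> :: "'a::euclidean_space \<Rightarrow> 'b::euclidean_space"
  assumes der: "\<And>z. (\<psi> has_derivative \<psi>' z) (at z)"
    and cont: "continuous_on UNIV (\<lambda>z. \<psi>' z e)"
    and K: "compact K" "\<And>z. z \<notin> K \<Longrightarrow> \<psi> z = 0"
  shows "(\<integral>z. \<psi>' z e \<partial>lborel) = 0"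
proof -
  obtain R where R: "R > 0" "K \<subseteq> ball 0 R"
    using K(1) compact_imp_bounded bounded_subset_ballD by (metis)
  have lin: "linear (\<psi>' z)" for z using der has_derivative_linear by blast
  have zero: "\<psi>' z e = 0" if "z \<notin> K" for z
    using derivative_eq_0_outside_support[OF der] K that by (metis compact_imp_closed)
  have "bounded ((\<lambda>z. \<psi>' z e) ` K)"
    by (rule compact_imp_bounded[OF compact_continuous_image]) (use cont K in \<open>auto intro: continuous_on_subset\<close>)
  then obtain B where B0: "\<And>z. z \<in> K \<Longrightarrow> norm (\<psi>' z e) \<le> B" by (auto simp: bounded_iff)
  then have B: "norm (\<psi>' z e) \<le> max B 0" for z
    using zero[of z] B0[of z] by (cases "z \<in> K") (auto intro: max.coboundedI1)
  define q where "q n z = real (Suc n) *\<^sub>R (\<psi> (z + (1 / real (Suc n)) *\<^sub>R e) - \<psi> z)" for n z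
  have cont\<psi>: "continuous_on UNIV \<psi>"
    by (intro continuous_at_imp_continuous_on ballI has_derivative_continuous[OF der])
  have int\<psi>: "integrable lborel \<psi>"
  proof -
    have "integrable lborel (\<lambda>z. indicator K z *\<^sub>R \<psi> z)"
      by (rule borel_integrable_compact) (use K cont\<psi> in \<open>auto intro: continuous_on_subset\<close>)
    moreover have "(\<lambda>z. indicator K z *\<^sub>R \<psi> z) = \<psi>" using K by (auto simp: indicator_def)
    ultimately show ?thesis by simp
  qed
  have line: "((\<lambda>t. \<psi> (z + t *\<^sub>R e)) has_derivative (\<lambda>s. s *\<^sub>R \<psi>' (z + t *\<^sub>R e) e)) (at t)" for z t
    by (rule has_derivative_compose[OF _ der, THEN has_derivative_eq_rhs])
      (auto intro!: derivative_eq_intros simp: linear_scale[OF lin])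
  have translate: "(\<integral>z. \<psi> (z + w) \<partial>lborel) = (\<integral>z. \<psi> z \<partial>lborel)" "integrable lborel (\<lambda>z. \<psi> (z + w))" for w
  proof -
    have "integrable (distr lborel borel ((+) w)) \<psi>" by (simp only: lborel_distr_plus int\<psi>)
    then show "integrable lborel (\<lambda>z. \<psi> (z + w))"
      using integrable_distr[of "(+) w" lborel borel \<psi>] by (simp add: add.commute)
    have "(\<integral>z. \<psi> z \<partial>lborel) = (\<integral>z. \<psi> z \<partial>distr lborel borel ((+) w))" by (simp only: lborel_distr_plus)
    also have "\<dots> = (\<integral>z. \<psi> (w + z) \<partial>lborel)"
      by (rule integral_distr) (use cont\<psi> in \<open>auto intro: borel_measurable_continuous_onI\<close>)
    finally show "(\<integral>z. \<psi> (z + w) \<partial>lborel) = (\<integral>z. \<psi> z \<partial>lborel)" by (simp add: add.commute)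
  qed
  have "(\<integral>z. q n z \<partial>lborel) = 0" for n
    unfolding q_def using translate int\<psi> by simp
  moreover have "(\<lambda>n. \<integral>z. q n z \<partial>lborel) \<longlonglongrightarrow> (\<integral>z. \<psi>' z e \<partial>lborel)"
  proof (rule integral_dominated_convergence[where w="\<lambda>z. indicator (cball 0 (R + norm e)) z *\<^sub>R max B 0"])
    show "(\<lambda>z. \<psi>' z e) \<in> borel_measurable lborel"
      using cont by (simp add: borel_measurable_continuous_onI)
    show "q n \<in> borel_measurable lborel" for n
      unfolding q_def using translate int\<psi> by (intro borel_measurable_integrable) simp
    show "integrable lborel (\<lambda>z. indicator (cball (0::'a) (R + norm e)) z *\<^sub>R max B 0)"
      by (rule borel_integrable_compact) auto
    have "(\<lambda>n. q n z) \<longlonglongrightarrow> \<psi>' z e" for z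
    proof -
      have "((\<lambda>h. norm (\<psi> (z + h *\<^sub>R e) - \<psi> z - h *\<^sub>R \<psi>' z e) / norm h) \<longlongrightarrow> 0) (at 0)"
        using line[of z 0] by (simp add: has_derivative_at)
      moreover have "eventually (\<lambda>h. norm (\<psi> (z + h *\<^sub>R e) - \<psi> z - h *\<^sub>R \<psi>' z e) / norm h
          = norm ((1 / h) *\<^sub>R (\<psi> (z + h *\<^sub>R e) - \<psi> z) - \<psi>' z e)) (at 0)"
      proof -
        have "norm (\<psi> (z + h *\<^sub>R e) - \<psi> z - h *\<^sub>R \<psi>' z e) / norm h
          = norm ((1 / h) *\<^sub>R (\<psi> (z + h *\<^sub>R e) - \<psi> z) - \<psi>' z e)" if "h \<noteq> 0" for h :: real
        proof -
          have "(1 / h) *\<^sub>R (\<psi> (z + h *\<^sub>R e) - \<psi> z) - \<psi>' z e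
              = (1 / h) *\<^sub>R (\<psi> (z + h *\<^sub>R e) - \<psi> z - h *\<^sub>R \<psi>' z e)"
            using that by (simp add: scaleR_diff_right)
          then show ?thesis by (simp add: divide_inverse)
        qed
        then show ?thesis by (simp add: eventually_at_filter)
      qed
      ultimately have "((\<lambda>h. norm ((1 / h) *\<^sub>R (\<psi> (z + h *\<^sub>R e) - \<psi> z) - \<psi>' z e)) \<longlongrightarrow> 0) (at 0)"
        by (rule Lim_transform_eventually)
      then have "((\<lambda>h. (1 / h) *\<^sub>R (\<psi> (z + h *\<^sub>R e) - \<psi> z)) \<longlongrightarrow> \<psi>' z e) (at 0)"
        by (rule LIM_zero_cancel[OF tendsto_norm_zero_cancel])
      then have "(\<lambda>n. (1 / (1 / real (Suc n))) *\<^sub>R (\<psi> (z + (1 / real (Suc n)) *\<^sub>R e) - \<psi> z)) \<longlonglongrightarrow> \<psi>' z e"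
        by (rule filterlim_compose)
          (use LIMSEQ_inverse_real_of_nat in \<open>auto simp: filterlim_at inverse_eq_divide\<close>)
      then show ?thesis by (simp add: q_def[abs_def])
    qed
    then show "AE z in lborel. (\<lambda>n. q n z) \<longlonglongrightarrow> \<psi>' z e" by simp
    have "norm (q n z) \<le> indicator (cball 0 (R + norm e)) z *\<^sub>R max B 0" for n z
    proof (cases "norm z \<le> R + norm e")
      case True
      have on: "onorm (\<lambda>s. s *\<^sub>R \<psi>' w e) \<le> max B 0" for w
        by (rule onorm_le) (use B[of w] in \<open>auto simp: mult.commute intro: mult_left_mono\<close>)
      have "norm (\<psi> (z + (1 / real (Suc n)) *\<^sub>R e) - \<psi> (z + 0 *\<^sub>R e)) \<le> max B 0 * norm (1 / real (Suc n) - 0)"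
        by (rule differentiable_bound[where S=UNIV and f="\<lambda>t. \<psi> (z + t *\<^sub>R e)"
            and f'="\<lambda>t s. s *\<^sub>R \<psi>' (z + t *\<^sub>R e) e"]) (use on line in auto)
      then have "real (Suc n) * norm (\<psi> (z + (1 / real (Suc n)) *\<^sub>R e) - \<psi> z) \<le> max B 0"
        by (simp add: field_simps)
      moreover have "norm (q n z) = real (Suc n) * norm (\<psi> (z + (1 / real (Suc n)) *\<^sub>R e) - \<psi> z)"
        unfolding q_def norm_scaleR by simp
      ultimately have "norm (q n z) \<le> max B 0" by simp
      then show ?thesis using True by simp
    next
      case False
      have "norm ((1 / real (Suc n)) *\<^sub>R e) \<le> norm e"
        by (simp add: divide_le_eq mult_le_cancel_left1 algebra_simps)
      then have "norm (z + (1 / real (Suc n)) *\<^sub>R e) > R" "norm z > R"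
        using False norm_triangle_ineq4[of "z + (1 / real (Suc n)) *\<^sub>R e" "(1 / real (Suc n)) *\<^sub>R e"]
          norm_ge_zero[of e] by (simp_all del: norm_ge_zero)
      then have "z + (1 / real (Suc n)) *\<^sub>R e \<notin> K" "z \<notin> K" using R by auto
      then show ?thesis using K False by (simp add: q_def)
    qed
    then show "AE z in lborel. norm (q n z) \<le> indicator (cball 0 (R + norm e)) z *\<^sub>R max B 0" for n by simp
  qed
  ultimately show ?thesis by (simp add: LIMSEQ_const_iff)
qed

section \<open>The duality estimate on the disc\<close>

text \<open>The integral of \<open>(norm (f x) - t * norm (g x))\<^sup>2\<close> is a nonnegative quadratic polynomial in \<open>t\<close>.\<close>

lemma L2_Cauchy_Schwarz:
  fixes f :: "'a \<Rightarrow> 'b::{banach, second_countable_topology}" and g :: "'a \<Rightarrow> 'c::{banach, second_countable_topology}"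
  assumes [measurable]: "f \<in> borel_measurable M" "g \<in> borel_measurable M"
    and f: "integrable M (\<lambda>x. (norm (f x))\<^sup>2)" and g: "integrable M (\<lambda>x. (norm (g x))\<^sup>2)"
  shows "integrable M (\<lambda>x. norm (f x) * norm (g x))"
    and "(\<integral>x. norm (f x) * norm (g x) \<partial>M) \<le> sqrt (\<integral>x. (norm (f x))\<^sup>2 \<partial>M) * sqrt (\<integral>x. (norm (g x))\<^sup>2 \<partial>M)"
proof -
  have am_gm: "a * b \<le> a\<^sup>2 + b\<^sup>2" if "0 \<le> a" "0 \<le> b" for a b :: real
    using sum_squares_bound[of a b] mult_nonneg_nonneg[OF that] by linarith
  show int: "integrable M (\<lambda>x. norm (f x) * norm (g x))"
    by (rule Bochner_Integration.integrable_bound[OF Bochner_Integration.integrable_add[OF f g]])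
      (auto intro!: AE_I2 am_gm)
  define A B C where "A = (\<integral>x. (norm (f x))\<^sup>2 \<partial>M)" and "B = (\<integral>x. (norm (g x))\<^sup>2 \<partial>M)"
    and "C = (\<integral>x. norm (f x) * norm (g x) \<partial>M)"
  have nonneg: "0 \<le> A" "0 \<le> B" "0 \<le> C" by (auto simp: A_def B_def C_def)
  have quad: "0 \<le> A - 2 * t * C + t\<^sup>2 * B" for t
  proof -
    have "0 \<le> (\<integral>x. (norm (f x) - t * norm (g x))\<^sup>2 \<partial>M)" by simp
    also have "\<dots> = (\<integral>x. (norm (f x))\<^sup>2 - 2 * t * (norm (f x) * norm (g x)) + t\<^sup>2 * (norm (g x))\<^sup>2 \<partial>M)"
      by (simp add: power2_diff power_mult_distrib algebra_simps)
    also have "\<dots> = A - 2 * t * C + t\<^sup>2 * B"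
      using int f g by (simp add: A_def B_def C_def)
    finally show ?thesis .
  qed
  have "C\<^sup>2 \<le> A * B"
  proof (cases "B = 0")
    case True
    have "C = 0"
    proof (rule ccontr)
      assume "C \<noteq> 0"
      \<comment> \<open>For \<open>B = 0\<close> the polynomial is linear, and this is where it takes the value \<open>-1\<close>.\<close>
      then show False using quad[of "(A + 1) / (2 * C)"] True by (simp add: field_simps)
    qed
    then show ?thesis using True by simp
  next
    case False
    then have "B > 0" using nonneg by simp
    \<comment> \<open>The minimum of the quadratic polynomial is at \<open>C / B\<close>.\<close>
    then show ?thesis using quad[of "C / B"] by (simp add: field_simps power2_eq_square)
  qed
  then have "C \<le> sqrt (A * B)" using real_le_rsqrt by blast
  then show "(\<integral>x. norm (f x) * norm (g x) \<partial>M) \<le> sqrt (\<integral>x. (norm (f x))\<^sup>2 \<partial>M) * sqrt (\<integral>x. (norm (g x))\<^sup>2 \<partial>M)"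
    by (simp add: A_def B_def C_def real_sqrt_mult)
qed

lemma lborel_integral_eq_lebesgue_on:
  fixes f :: "'a::euclidean_space \<Rightarrow> 'b::euclidean_space"
  assumes f: "f \<in> borel_measurable borel" and S: "S \<in> sets lebesgue" "\<And>x. x \<notin> S \<Longrightarrow> f x = 0"
  shows "(\<integral>x. f x \<partial>lborel) = (\<integral>x. f x \<partial>lebesgue_on S)"
proof -
  have "(\<integral>x. f x \<partial>lebesgue_on S) = (\<integral>x. indicator S x *\<^sub>R f x \<partial>lebesgue)"
    using S by (simp add: integral_restrict_space)
  also have "(\<lambda>x. indicator S x *\<^sub>R f x) = f" using S by (auto simp: indicator_def)
  finally show ?thesis using f by (simp add: integral_completion)
qed

lemma has_derivative_imp_continuous_UNIV:
  "(\<And>z. (f has_derivative f' z) (at z)) \<Longrightarrow> continuous_on UNIV f"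
  by (intro continuous_at_imp_continuous_on ballI has_derivative_continuous)

text \<open>The complex vector field \<open>H = f * cnj p - cnj P\<close> has divergence \<open>Re (2 * \<partial>H / \<partial>z) = 2 * \<bar>p\<bar>\<^sup>2\<close>,
  because \<open>f' = p\<close> and antiholomorphic functions do not contribute. Integrating the divergence of
  \<open>v * H\<close> over the disc expresses the left-hand side by \<open>H\<close> and the gradient of \<open>v\<close>.\<close>

lemma disc_duality:
  fixes v :: "complex \<Rightarrow> real"
  assumes v: "\<And>z. (v has_derivative v' z) (at z)" and v1: "continuous_on UNIV (\<lambda>z. v' z 1)"
    and v2: "continuous_on UNIV (\<lambda>z. v' z \<i>)"
    and K: "compact K" "K \<subseteq> ball 0 1" "\<And>z. z \<notin> K \<Longrightarrow> v z = 0"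
    and f: "\<And>z. (f has_field_derivative p z) (at z)"
    and p: "p holomorphic_on UNIV" and P: "P holomorphic_on UNIV"
  shows "\<bar>\<integral>z. v z * (cmod (p z))\<^sup>2 \<partial>disc\<bar>
    \<le> sqrt (\<integral>z. (cmod (Complex (v' z 1) (v' z \<i>)))\<^sup>2 \<partial>disc) * sqrt (\<integral>z. (cmod (cnj (f z) * p z - P z))\<^sup>2 \<partial>disc) / 2"
proof -
  define p1 P1 where "p1 = deriv p" and "P1 = deriv P"
  have p1: "(p has_field_derivative p1 z) (at z)" and P1: "(P has_field_derivative P1 z) (at z)" for z
    using p P by (auto simp: p1_def P1_def intro: holomorphic_derivI)
  have cont: "continuous_on UNIV p1" "continuous_on UNIV P1" "continuous_on UNIV p" "continuous_on UNIV P"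
    using p P by (auto simp: p1_def P1_def intro!: holomorphic_on_imp_continuous_on holomorphic_deriv)
  have contf: "continuous_on UNIV f"
    using f by (intro continuous_at_imp_continuous_on ballI DERIV_isCont)
  have contv: "continuous_on UNIV v" using v by (rule has_derivative_imp_continuous_UNIV)
  define H where "H z = f z * cnj (p z) - cnj (P z)" for z
  define H' where "H' z h = f z * cnj (p1 z * h) + p z * h * cnj (p z) - cnj (P1 z * h)" for z h
  define \<psi>' where "\<psi>' z h = v z *\<^sub>R H' z h + v' z h *\<^sub>R H z" for z h
  have H: "(H has_derivative H' z) (at z)" for z
  proof -
    have "(p has_derivative (\<lambda>h. p1 z * h)) (at z)" "(P has_derivative (\<lambda>h. P1 z * h)) (at z)"
       "(f has_derivative (\<lambda>h. p z * h)) (at z)"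
      using p1[of z] P1[of z] f[of z] by (auto simp: has_field_derivative_def)
    then show ?thesis unfolding H_def[abs_def] H'_def[abs_def]
      by (auto intro!: derivative_eq_intros bounded_linear.has_derivative[OF bounded_linear_cnj])
  qed
  have \<psi>: "((\<lambda>z. v z *\<^sub>R H z) has_derivative \<psi>' z) (at z)" for z
    using has_derivative_scaleR[OF v H] unfolding \<psi>'_def[abs_def] by blast
  have contH: "continuous_on UNIV H" using H by (rule has_derivative_imp_continuous_UNIV)
  have cont\<psi>: "continuous_on UNIV (\<lambda>z. \<psi>' z 1)" "continuous_on UNIV (\<lambda>z. \<psi>' z \<i>)"
    unfolding \<psi>'_def H'_def by (intro continuous_intros contv v1 v2 cont contf contH)+
  have supp: "v z *\<^sub>R H z = 0" if "z \<notin> K" for z using K(3)[OF that] by simp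
  have "\<psi>' z = (\<lambda>_. 0)" if "z \<notin> K" for z
    by (rule derivative_eq_0_outside_support[OF \<psi>, of K]) (use K supp that in \<open>auto simp: compact_imp_closed\<close>)
  then have zero: "\<psi>' z h = 0" if "z \<notin> ball 0 1" for z h
    using that K(2) by (metis subsetD)
  have "(\<integral>z. \<psi>' z e \<partial>disc) = 0" if "continuous_on UNIV (\<lambda>z. \<psi>' z e)" for e
  proof -
    have "(\<integral>z. \<psi>' z e \<partial>lborel) = 0"
      by (rule integral_directional_derivative_eq_0[OF \<psi> that K(1) supp])
    then show ?thesis
      using lborel_integral_eq_lebesgue_on[of "\<lambda>z. \<psi>' z e" "ball 0 1"] zero that
      by (simp add: borel_measurable_continuous_onI)
  qed
  with cont\<psi> have "(\<integral>z. \<psi>' z 1 \<partial>disc) = 0" "(\<integral>z. \<psi>' z \<i> \<partial>disc) = 0" by auto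
  then have zero_int: "(\<integral>z. \<psi>' z 1 - \<i> * \<psi>' z \<i> \<partial>disc) = 0"
    using cont\<psi> by (simp add: integrable_disc)
  define N where "N z = Complex (v' z 1) (v' z \<i>)" for z
  have contN: "continuous_on UNIV N" unfolding N_def by (intro continuous_on_Complex v1 v2)
  \<comment> \<open>The operator \<open>\<partial>/\<partial>x - \<i> * \<partial>/\<partial>y\<close> is \<open>2 * \<partial>/\<partial>z\<close>, whose real part is the divergence.\<close>
  have pointwise: "\<psi>' z 1 - \<i> * \<psi>' z \<i> = of_real (2 * (v z * (cmod (p z))\<^sup>2)) + cnj (N z) * H z" for z
  proof -
    have "\<psi>' z 1 - \<i> * \<psi>' z \<i> = 2 * of_real (v z) * (p z * cnj (p z)) + cnj (N z) * H z"
      by (simp add: \<psi>'_def H'_def N_def scaleR_conv_of_real Complex_eq algebra_simps)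
    then show ?thesis by (simp add: complex_norm_square algebra_simps del: of_real_power flip: complex_norm_square)
  qed
  have intp: "integrable disc (\<lambda>z. v z * (cmod (p z))\<^sup>2)"
    by (intro integrable_disc continuous_intros contv cont)
  have intN: "integrable disc (\<lambda>z. cnj (N z) * H z)"
    by (intro integrable_disc continuous_intros contN contH)
  have "of_real (2 * (\<integral>z. v z * (cmod (p z))\<^sup>2 \<partial>disc)) = - (\<integral>z. cnj (N z) * H z \<partial>disc)"
  proof -
    have "0 = (\<integral>z. complex_of_real (2 * (v z * (cmod (p z))\<^sup>2)) \<partial>disc) + (\<integral>z. cnj (N z) * H z \<partial>disc)"
      using zero_int unfolding pointwise
      by (subst Bochner_Integration.integral_add[symmetric]) (use intp intN in \<open>auto intro!: integrable_of_real simp del: of_real_mult\<close>)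
    then show ?thesis
      by (simp only: integral_complex_of_real integral_mult_right_zero) (simp add: eq_neg_iff_add_eq_0)
  qed
  then have "cmod (of_real (2 * (\<integral>z. v z * (cmod (p z))\<^sup>2 \<partial>disc))) = cmod (\<integral>z. cnj (N z) * H z \<partial>disc)"
    by (simp only: norm_minus_cancel)
  then have "2 * \<bar>\<integral>z. v z * (cmod (p z))\<^sup>2 \<partial>disc\<bar> = cmod (\<integral>z. cnj (N z) * H z \<partial>disc)"
    by (simp only: norm_of_real abs_mult abs_numeral)
  also have "\<dots> \<le> (\<integral>z. cmod (N z) * cmod (H z) \<partial>disc)"
    using integral_norm_bound[of disc "\<lambda>z. cnj (N z) * H z"] by (simp add: norm_mult)
  also have "\<dots> \<le> sqrt (\<integral>z. (cmod (N z))\<^sup>2 \<partial>disc) * sqrt (\<integral>z. (cmod (H z))\<^sup>2 \<partial>disc)"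
    using contN contH
    by (intro L2_Cauchy_Schwarz borel_measurable_integrable integrable_disc continuous_intros)
  also have "(\<lambda>z. cmod (H z)) = (\<lambda>z. cmod (cnj (f z) * p z - P z))"
  proof
    fix z
    have "H z = cnj (cnj (f z) * p z - P z)" by (simp add: H_def)
    then show "cmod (H z) = cmod (cnj (f z) * p z - P z)" by (metis complex_mod_cnj)
  qed
  then have "sqrt (\<integral>z. (cmod (H z))\<^sup>2 \<partial>disc) = sqrt (\<integral>z. (cmod (cnj (f z) * p z - P z))\<^sup>2 \<partial>disc)"
    by (simp only: fun_eq_iff)
  finally show ?thesis by (simp add: N_def)
qed

text \<open>In \<open>disc_duality\<close> the field is chosen by \<open>polynomial_projection_bound\<close>. With the coefficients of the
  primitive of \<open>p\<close> both sums in that bound are the same number \<open>S\<close>, and \<open>pi * S\<close> is the integral of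
  \<open>\<bar>p\<bar>\<^sup>2\<close>.\<close>

lemma disc_estimate_polynomial:
  fixes v :: "complex \<Rightarrow> real" and b :: "nat \<Rightarrow> complex" and M :: nat
  assumes v: "\<And>z. (v has_derivative v' z) (at z)" and v1: "continuous_on UNIV (\<lambda>z. v' z 1)"
    and v2: "continuous_on UNIV (\<lambda>z. v' z \<i>)"
    and K: "compact K" "K \<subseteq> ball 0 1" "\<And>z. z \<notin> K \<Longrightarrow> v z = 0"
  defines "p \<equiv> \<lambda>z. \<Sum>m\<le>M. b m * z ^ m"
  shows "\<bar>\<integral>z. v z * (cmod (p z))\<^sup>2 \<partial>disc\<bar>
    \<le> sqrt (\<integral>z. (cmod (Complex (v' z 1) (v' z \<i>)))\<^sup>2 \<partial>disc) * (\<integral>z. (cmod (p z))\<^sup>2 \<partial>disc) / sqrt (8 * pi)"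
proof -
  define a where "a n = b (n - 1) / of_nat n" for n
  define f where "f z = (\<Sum>n=1..Suc M. a n * z ^ n)" for z
  define S where "S = (\<Sum>m\<le>M. (cmod (b m))\<^sup>2 / (real m + 1))"
  have S: "S \<ge> 0" by (auto simp: S_def intro!: sum_nonneg)
  have shift: "(\<Sum>n=1..Suc M. h n) = (\<Sum>m\<le>M. h (Suc m))" for h :: "nat \<Rightarrow> 'z::comm_monoid_add"
    by (rule sum.reindex_bij_witness[where i=Suc and j="\<lambda>n. n - 1"]) auto
  have aS: "(\<Sum>n=1..Suc M. real n * (cmod (a n))\<^sup>2) = S"
  proof -
    have "real k * (c / (real k)\<^sup>2) = c / real k" for k c
      by (simp add: power2_eq_square)
    then have "real (Suc m) * (cmod (a (Suc m)))\<^sup>2 = (cmod (b m))\<^sup>2 / real (Suc m)" for m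
      unfolding a_def norm_divide norm_of_nat power_divide diff_Suc_1 by blast
    then show ?thesis unfolding shift S_def by (simp add: add.commute)
  qed
  have f: "(f has_field_derivative p z) (at z)" for z
  proof -
    have "a (Suc m) * (of_nat (Suc m) * z ^ m) = b m * z ^ m" for m
      by (simp add: a_def del: of_nat_Suc)
    moreover have "((\<lambda>z. a (Suc m) * z ^ Suc m) has_field_derivative a (Suc m) * (of_nat (Suc m) * z ^ m)) (at z)" for m
      by (rule DERIV_cmult) (auto intro!: derivative_eq_intros simp del: of_nat_Suc power_Suc)
    ultimately show ?thesis
      unfolding f_def shift p_def by (intro DERIV_sum) metis
  qed
  have "\<exists>P. P holomorphic_on UNIV \<and> (\<integral>z. (cmod (cnj (f z) * p z - P z))\<^sup>2 \<partial>disc)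
     \<le> pi / 2 * (\<Sum>n=1..Suc M. real n * (cmod (a n))\<^sup>2) * (\<Sum>m\<le>M. (cmod (b m))\<^sup>2 / (real m + 1))"
    unfolding f_def p_def by (rule polynomial_projection_bound)
  then obtain P where P: "P holomorphic_on UNIV"
     "(\<integral>z. (cmod (cnj (f z) * p z - P z))\<^sup>2 \<partial>disc) \<le> pi / 2 * S * S"
    unfolding aS S_def[symmetric] by (elim exE conjE)
  have pS: "(\<integral>z. (cmod (p z))\<^sup>2 \<partial>disc) = pi * S"
    unfolding p_def S_def by (rule integral_polynomial_square)
  have hol: "p holomorphic_on UNIV" unfolding p_def by (intro holomorphic_intros)
  have "\<bar>\<integral>z. v z * (cmod (p z))\<^sup>2 \<partial>disc\<bar>
    \<le> sqrt (\<integral>z. (cmod (Complex (v' z 1) (v' z \<i>)))\<^sup>2 \<partial>disc) * sqrt (\<integral>z. (cmod (cnj (f z) * p z - P z))\<^sup>2 \<partial>disc) / 2"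
    by (rule disc_duality[OF v v1 v2 K f hol P(1)])
  also have "\<dots> \<le> sqrt (\<integral>z. (cmod (Complex (v' z 1) (v' z \<i>)))\<^sup>2 \<partial>disc) * sqrt (pi / 2 * S * S) / 2"
    using P(2) by (intro divide_right_mono mult_left_mono real_sqrt_le_mono) auto
  also have "sqrt (pi / 2 * S * S) = 2 * (pi * S) / sqrt (8 * pi)"
  proof -
    have "pi / 2 * S * S = (2 * (pi * S) / sqrt (8 * pi))\<^sup>2"
      by (simp add: power_divide power_mult_distrib) (simp add: power2_eq_square)
    then show ?thesis using S by simp
  qed
  finally show ?thesis unfolding pS by simp
qed

text \<open>The radius of convergence exceeds \<open>1\<close>, so the Taylor polynomials are bounded on the disc
  by the sum of the absolute values of the coefficients, and all integrals converge.\<close>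

lemma disc_estimate_holomorphic:
  fixes v :: "complex \<Rightarrow> real" and q :: "complex \<Rightarrow> complex"
  assumes v: "\<And>z. (v has_derivative v' z) (at z)" and v1: "continuous_on UNIV (\<lambda>z. v' z 1)"
    and v2: "continuous_on UNIV (\<lambda>z. v' z \<i>)"
    and K: "compact K" "K \<subseteq> ball 0 1" "\<And>z. z \<notin> K \<Longrightarrow> v z = 0"
    and q: "q holomorphic_on ball 0 \<rho>" and \<rho>: "1 < \<rho>"
  shows "\<bar>\<integral>z. v z * (cmod (q z))\<^sup>2 \<partial>disc\<bar>
    \<le> sqrt (\<integral>z. (cmod (Complex (v' z 1) (v' z \<i>)))\<^sup>2 \<partial>disc) * (\<integral>z. (cmod (q z))\<^sup>2 \<partial>disc) / sqrt (8 * pi)"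
proof -
  define b where "b n = (deriv ^^ n) q 0 / fact n" for n
  have ser: "(\<lambda>n. b n * z ^ n) sums q z" if "cmod z < \<rho>" for z
    using holomorphic_power_series[OF q, of z] that by (simp add: b_def)
  have "summable (\<lambda>n. b n * of_real ((1 + \<rho>) / 2) ^ n)"
    by (rule sums_summable[OF ser], subst norm_of_real) (use \<rho> in simp)
  then have summ: "summable (\<lambda>n. norm (b n * 1 ^ n))"
    by (rule powser_insidea, subst norm_of_real) (use \<rho> in simp)
  define B where "B = (\<Sum>n. norm (b n))"
  define p where "p M z = (\<Sum>m\<le>M. b m * z ^ m)" for M z
  have pB: "cmod (p M z) \<le> B" if "cmod z < 1" for M z
  proof -
    have "cmod (p M z) \<le> (\<Sum>m\<le>M. norm (b m))"
      unfolding p_def using that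
      by (intro sum_norm_le) (auto simp: norm_mult norm_power intro!: mult_left_le power_le_one)
    also have "\<dots> \<le> B" unfolding B_def using summ by (intro sum_le_suminf) auto
    finally show ?thesis .
  qed
  have lim: "(\<lambda>M. p M z) \<longlonglongrightarrow> q z" if "cmod z < 1" for z
    using ser[of z] that \<rho> unfolding p_def sums_def_le by simp
  have contv: "continuous_on UNIV v" using v by (rule has_derivative_imp_continuous_UNIV)
  have contp: "continuous_on UNIV (p M)" for M unfolding p_def by (intro continuous_intros)
  have contq: "continuous_on (cball 0 1) q"
    using q \<rho> by (intro holomorphic_on_imp_continuous_on) (auto elim: holomorphic_on_subset)
  have conv: "(\<lambda>M. \<integral>z. w z * (cmod (p M z))\<^sup>2 \<partial>disc) \<longlonglongrightarrow> (\<integral>z. w z * (cmod (q z))\<^sup>2 \<partial>disc)"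
    if w: "continuous_on UNIV w" for w :: "complex \<Rightarrow> real"
  proof (rule integral_dominated_convergence[where w="\<lambda>z. \<bar>w z\<bar> * B\<^sup>2"])
    have "integrable disc (\<lambda>z. w z * (cmod (q z))\<^sup>2)"
      by (rule integrable_on_subset_of_compact[of "cball 0 1"])
        (auto intro!: continuous_intros contq continuous_on_subset[OF w])
    then show "(\<lambda>z. w z * (cmod (q z))\<^sup>2) \<in> borel_measurable disc" by blast
    show "(\<lambda>z. w z * (cmod (p M z))\<^sup>2) \<in> borel_measurable disc" for M
      by (intro borel_measurable_integrable integrable_disc continuous_intros contp w)
    show "integrable disc (\<lambda>z. \<bar>w z\<bar> * B\<^sup>2)"
      by (intro integrable_disc continuous_intros w)
    show "AE z in disc. (\<lambda>M. w z * (cmod (p M z))\<^sup>2) \<longlonglongrightarrow> w z * (cmod (q z))\<^sup>2"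
      by (rule AE_I2) (auto intro!: tendsto_intros lim)
    show "AE z in disc. norm (w z * (cmod (p M z))\<^sup>2) \<le> \<bar>w z\<bar> * B\<^sup>2" for M
      by (rule AE_I2) (auto simp: abs_mult intro!: mult_left_mono power_mono pB)
  qed
  have l1: "(\<lambda>M. \<bar>\<integral>z. v z * (cmod (p M z))\<^sup>2 \<partial>disc\<bar>) \<longlonglongrightarrow> \<bar>\<integral>z. v z * (cmod (q z))\<^sup>2 \<partial>disc\<bar>"
    by (intro tendsto_rabs conv contv)
  have l2: "(\<lambda>M. sqrt (\<integral>z. (cmod (Complex (v' z 1) (v' z \<i>)))\<^sup>2 \<partial>disc) * (\<integral>z. (cmod (p M z))\<^sup>2 \<partial>disc) / sqrt (8 * pi))
     \<longlonglongrightarrow> sqrt (\<integral>z. (cmod (Complex (v' z 1) (v' z \<i>)))\<^sup>2 \<partial>disc) * (\<integral>z. (cmod (q z))\<^sup>2 \<partial>disc) / sqrt (8 * pi)"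
    using conv[of "\<lambda>_. 1"] by (intro tendsto_intros) auto
  show ?thesis
    by (rule LIMSEQ_le[OF l1 l2]) (use disc_estimate_polynomial[OF v v1 v2 K] in \<open>auto simp: p_def\<close>)
qed

section \<open>Transplanting test functions by the Riemann map\<close>

lemma test_function_has_derivative:
  assumes "test_function \<Omega> \<phi>"
  shows "(\<phi> has_derivative (\<lambda>h. grad \<phi> z \<bullet> h)) (at z)"
proof -
  have "continuously_differentiable (Suc 0) \<phi>" using assms unfolding test_function_def by blast
  then have d: "(\<phi> has_derivative frechet_derivative \<phi> (at z)) (at z)"
    using frechet_derivative_works by auto
  then have lin: "linear (frechet_derivative \<phi> (at z))" using has_derivative_linear by blast
  have "frechet_derivative \<phi> (at z) h = grad \<phi> z \<bullet> h" for h
  proof -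
    have "frechet_derivative \<phi> (at z) (Re h *\<^sub>R 1 + Im h *\<^sub>R \<i>)
        = Re h * frechet_derivative \<phi> (at z) 1 + Im h * frechet_derivative \<phi> (at z) \<i>"
      using lin by (simp only: linear_add linear_scale real_scaleR_def)
    moreover have "Re h *\<^sub>R 1 + Im h *\<^sub>R \<i> = h" by (simp add: complex_eq_iff)
    ultimately show ?thesis by (simp add: grad_def inner_complex_def mult.commute)
  qed
  then have "frechet_derivative \<phi> (at z) = (\<lambda>h. grad \<phi> z \<bullet> h)" by blast
  then show ?thesis using d by simp
qed

lemma test_function_continuous_grad:
  assumes "test_function \<Omega> \<phi>"
  shows "continuous_on UNIV (grad \<phi>)"
proof -
  have "continuously_differentiable (Suc 0) \<phi>" using assms unfolding test_function_def by blast
  then show ?thesis unfolding grad_def[abs_def] by (auto intro: continuous_on_Complex)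
qed

lemma test_function_continuous:
  assumes "test_function \<Omega> \<phi>"
  shows "continuous_on UNIV \<phi>"
proof -
  have "continuously_differentiable 0 \<phi>" using assms unfolding test_function_def by blast
  then show ?thesis by simp
qed

lemma test_function_support:
  assumes "test_function \<Omega> \<phi>"
  obtains K where "compact K" "K \<subseteq> \<Omega>" "\<And>z. z \<notin> K \<Longrightarrow> \<phi> z = 0" "\<And>z. z \<notin> K \<Longrightarrow> grad \<phi> z = 0"
proof
  let ?K = "closure {z. \<phi> z \<noteq> 0}"
  show "compact ?K" "?K \<subseteq> \<Omega>" using assms unfolding test_function_def by auto
  show z: "\<phi> z = 0" if "z \<notin> ?K" for z
    using that closure_subset[of "{z. \<phi> z \<noteq> 0}"] by blast
  show "grad \<phi> z = 0" if "z \<notin> ?K" for z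
  proof -
    have "(\<lambda>h. grad \<phi> z \<bullet> h) = (\<lambda>_. 0)"
      by (rule derivative_eq_0_outside_support[OF test_function_has_derivative[OF assms] closed_closure z that])
    from fun_cong[OF this, of "grad \<phi> z"] have "grad \<phi> z \<bullet> grad \<phi> z = 0" by simp
    then show ?thesis by simp
  qed
qed

lemma lebesgue_on_supported:
  fixes f :: "'a::euclidean_space \<Rightarrow> 'b::euclidean_space"
  assumes "continuous_on UNIV f" "compact K" "\<And>x. x \<notin> K \<Longrightarrow> f x = 0" "K \<subseteq> S" "S \<in> sets lebesgue"
  shows "integrable (lebesgue_on S) f" and "(\<integral>x. f x \<partial>lebesgue_on S) = (\<integral>x. f x \<partial>lborel)"
proof -
  show "(\<integral>x. f x \<partial>lebesgue_on S) = (\<integral>x. f x \<partial>lborel)"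
    by (rule lborel_integral_eq_lebesgue_on[symmetric])
      (use assms in \<open>auto intro: borel_measurable_continuous_onI\<close>)
  have "integrable lborel (\<lambda>x. indicator K x *\<^sub>R f x)"
    by (rule borel_integrable_compact) (use assms in \<open>auto intro: continuous_on_subset\<close>)
  also have "(\<lambda>x. indicator K x *\<^sub>R f x) = (\<lambda>x. indicator S x *\<^sub>R f x)"
    using assms by (auto simp: indicator_def fun_eq_iff)
  finally show "integrable (lebesgue_on S) f"
    using assms by (simp add: integrable_restrict_space integrable_completion)
qed

text \<open>The Riemann map \<open>g\<close> is replaced by \<open>G z = g (r * z)\<close> with \<open>r < 1\<close>, so that it is holomorphic beyond
  the closed disc, while \<open>r\<close> is so close to \<open>1\<close> that the image still contains the support of \<open>\<phi>\<close>.
  For \<open>v = \<phi> \<circ> G\<close> the Dirichlet integral is conformally invariant, the mean of \<open>\<phi>\<close> turns into the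
  weighted mean of \<open>v\<close> in \<open>disc_estimate_holomorphic\<close>, and the integral of \<open>\<bar>G'\<bar>\<^sup>2\<close> over the disc is
  the area of its image under \<open>G\<close>.\<close>

lemma test_function_mean_bound:
  assumes \<Omega>: "open \<Omega>" "\<Omega> \<noteq> {}" "bounded \<Omega>" "simply_connected \<Omega>"
    and \<phi>: "test_function \<Omega> \<phi>"
  shows "\<bar>\<integral>z. \<phi> z \<partial>lebesgue_on \<Omega>\<bar> \<le> measure lebesgue \<Omega> / sqrt (8 * pi) * L2_norm \<Omega> (grad \<phi>)"
proof -
  obtain K where K: "compact K" "K \<subseteq> \<Omega>" "\<And>z. z \<notin> K \<Longrightarrow> \<phi> z = 0" "\<And>z. z \<notin> K \<Longrightarrow> grad \<phi> z = 0"
    using test_function_support[OF \<phi>] by blast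
  have "\<Omega> \<noteq> UNIV" using \<Omega>(3) not_bounded_UNIV by blast
  then obtain k g where k: "k holomorphic_on \<Omega>" and g: "g holomorphic_on ball 0 1"
    and kg: "\<And>z. z \<in> \<Omega> \<Longrightarrow> k z \<in> ball 0 1 \<and> g (k z) = z"
    and gk: "\<And>z. z \<in> ball 0 1 \<Longrightarrow> g z \<in> \<Omega> \<and> k (g z) = z"
    using simply_connected_eq_biholomorphic_to_disc[OF \<Omega>(1)] \<Omega> by metis
  have kK: "compact (k ` K)"
    using K k by (intro compact_continuous_image) (auto intro: holomorphic_on_imp_continuous_on holomorphic_on_subset)
  obtain r where r: "0 < r" "r < 1" "k ` K \<subseteq> ball 0 r"
  proof (cases "K = {}")
    case True then show ?thesis using that[of "1/2"] by auto
  next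
    case False
    obtain x where x: "x \<in> k ` K" "\<And>y. y \<in> k ` K \<Longrightarrow> cmod y \<le> cmod x"
      using continuous_attains_sup[OF kK, of cmod] False by (auto intro: continuous_intros)
    obtain w where "w \<in> K" "x = k w" using x(1) by blast
    then have x1: "cmod x < 1" using kg[of w] K(2) by auto
    show ?thesis
    proof (rule that[of "(cmod x + 1) / 2"])
      show "0 < (cmod x + 1) / 2" by (simp add: add_nonneg_pos)
      show "(cmod x + 1) / 2 < 1" using x1 by simp
      show "k ` K \<subseteq> ball 0 ((cmod x + 1) / 2)"
      proof
        fix y assume "y \<in> k ` K"
        then have "cmod y \<le> cmod x" by (rule x(2))
        then show "y \<in> ball 0 ((cmod x + 1) / 2)" using x1 by simp
      qed
    qed
  qed
  define G where "G z = g (of_real r * z)" for z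
  define q where "q z = of_real r * deriv g (of_real r * z)" for z
  have rz: "of_real r * z \<in> ball 0 1" if "z \<in> ball 0 (1 / r)" for z :: complex
    using that r by (simp add: norm_mult field_simps)
  have sub: "ball (0::complex) 1 \<subseteq> ball 0 (1 / r)" using r by (intro subset_ball) (simp add: field_simps)
  have G': "(G has_field_derivative q z) (at z)" if "z \<in> ball 0 (1 / r)" for z
  proof -
    have "(g has_field_derivative deriv g (of_real r * z)) (at (of_real r * z))"
      by (rule holomorphic_derivI[OF g]) (use rz[OF that] in auto)
    then show ?thesis unfolding G_def q_def
      by (rule DERIV_chain2[THEN DERIV_cong]) (auto intro!: derivative_eq_intros)
  qed
  have q: "q holomorphic_on ball 0 (1 / r)"
  proof -
    have dg: "deriv g holomorphic_on ball 0 1" by (rule holomorphic_deriv[OF g open_ball])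
    have "(deriv g \<circ> (\<lambda>z. of_real r * z)) holomorphic_on ball 0 (1 / r)"
      by (rule holomorphic_on_compose_gen[OF _ dg]) (use rz in \<open>blast intro: holomorphic_intros\<close>)+
    then show ?thesis unfolding q_def[abs_def] o_def by (intro holomorphic_intros)
  qed
  have Gin: "G z \<in> \<Omega>" and kG: "k (G z) = of_real r * z" if "z \<in> ball 0 1" for z
    using gk[OF rz[OF subsetD[OF sub that]]] by (simp_all add: G_def)
  have injG: "inj_on G (ball 0 1)"
  proof (rule inj_onI)
    fix x y assume "x \<in> ball 0 1" "y \<in> ball 0 1" "G x = G y"
    then have "of_real r * x = of_real r * y" using kG by metis
    then show "x = y" using r by simp
  qed
  have GD: "G ` ball 0 1 \<subseteq> \<Omega>" using Gin by blast
  have holG: "G holomorphic_on ball 0 1"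
    using G'[OF subsetD[OF sub]] unfolding holomorphic_on_open[OF open_ball] by blast
  then have openG: "open (G ` ball 0 1)"
    by (rule open_mapping_thm3[OF _ open_ball injG])
  define K' where "K' = (\<lambda>w. w / of_real r) ` k ` K"
  have K'c: "compact K'" unfolding K'_def
    by (rule compact_continuous_image[OF _ kK]) (use r in \<open>auto intro!: continuous_intros\<close>)
  have K'D: "K' \<subseteq> ball 0 1" using r unfolding K'_def by (auto simp: norm_divide)
  have K'mem: "z \<in> K'" if "z \<in> ball 0 1" "G z \<in> K" for z
  proof -
    have "z = k (G z) / of_real r" using kG[OF that(1)] r by simp
    then show ?thesis using that(2) unfolding K'_def by blast
  qed
  have KG: "K \<subseteq> G ` ball 0 1"
  proof
    fix w assume w: "w \<in> K"
    then have "k w / of_real r \<in> ball 0 1" using K'D unfolding K'_def by blast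
    moreover have "G (k w / of_real r) = w"
      using kg[OF subsetD[OF K(2) w]] r unfolding G_def by simp
    ultimately show "w \<in> G ` ball 0 1" by (metis imageI)
  qed
  \<comment> \<open>Nothing is known about \<open>g\<close> outside the unit disc, hence the explicit extension by zero.\<close>
  define v where "v z = (if z \<in> ball 0 1 then \<phi> (G z) else 0)" for z
  define v' where "v' z h = (if z \<in> ball 0 1 then grad \<phi> (G z) \<bullet> (q z * h) else 0)" for z h
  have v0: "v z = 0" "v' z h = 0" if "z \<notin> K'" for z h
  proof -
    have "\<phi> (G z) = 0 \<and> grad \<phi> (G z) = 0" if "z \<in> ball 0 1"
      using K'mem[OF that] \<open>z \<notin> K'\<close> K(3,4) by blast
    then show "v z = 0" "v' z h = 0" by (simp_all add: v_def v'_def)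
  qed
  have v: "(v has_derivative v' z) (at z)" for z
  proof (cases "z \<in> ball 0 1")
    case True
    have "(G has_derivative (*) (q z)) (at z)"
      using G'[OF subsetD[OF sub True]] by (simp add: has_field_derivative_def)
    then have "((\<lambda>z. \<phi> (G z)) has_derivative (\<lambda>h. grad \<phi> (G z) \<bullet> (q z * h))) (at z)"
      by (rule has_derivative_compose[OF _ test_function_has_derivative[OF \<phi>]])
    then have "(v has_derivative (\<lambda>h. grad \<phi> (G z) \<bullet> (q z * h))) (at z)"
      by (rule has_derivative_transform_within_open[of _ _ _ _ "ball 0 1"]) (use True in \<open>auto simp: v_def\<close>)
    then show ?thesis using True by (simp add: v'_def[abs_def])
  next
    case False
    have "((\<lambda>_. 0) has_derivative (\<lambda>_. 0)) (at z)" by simp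
    then have "(v has_derivative (\<lambda>_. 0)) (at z)"
      by (rule has_derivative_transform_within_open[of _ _ _ _ "- K'"])
        (use False K'c K'D v0 in \<open>auto simp: compact_imp_closed open_Compl\<close>)
    then show ?thesis using False by (simp add: v'_def[abs_def])
  qed
  have contG: "continuous_on (ball 0 1) G" "continuous_on (ball 0 1) q"
    using holomorphic_on_imp_continuous_on[OF holG]
      holomorphic_on_imp_continuous_on[OF holomorphic_on_subset[OF q sub]] by auto
  have contv': "continuous_on UNIV (\<lambda>z. v' z e)" for e
  proof -
    have "continuous_on (ball 0 1) (\<lambda>z. grad \<phi> (G z) \<bullet> (q z * e))"
      using test_function_continuous_grad[OF \<phi>] contG
      by (intro continuous_intros continuous_on_compose2[of UNIV "grad \<phi>" _ G]) auto
    then have "continuous_on (ball 0 1) (\<lambda>z. v' z e)"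
      by (rule continuous_on_eq) (auto simp: v'_def)
    moreover have "continuous_on (- K') (\<lambda>z. v' z e)"
      by (rule continuous_on_eq[OF continuous_on_const[of _ 0]]) (auto simp: v0)
    moreover have "ball 0 1 \<union> - K' = UNIV" using K'D by auto
    ultimately show ?thesis
      using continuous_on_open_Un[of "ball 0 1" "- K'"] K'c by (auto simp: compact_imp_closed open_Compl)
  qed
  have est: "\<bar>\<integral>z. v z * (cmod (q z))\<^sup>2 \<partial>disc\<bar>
    \<le> sqrt (\<integral>z. (cmod (Complex (v' z 1) (v' z \<i>)))\<^sup>2 \<partial>disc) * (\<integral>z. (cmod (q z))\<^sup>2 \<partial>disc) / sqrt (8 * pi)"
    by (rule disc_estimate_holomorphic[OF v contv' contv' K'c K'D v0(1) q less_divide_eq_1_pos[THEN iffD2, OF r(1,2)]])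
  have GL: "G ` ball 0 1 \<in> sets lebesgue" and OL: "\<Omega> \<in> sets lebesgue" using openG \<Omega>(1) by auto
  have change: "(\<integral>z. (cmod (q z))\<^sup>2 * h (G z) \<partial>disc) = (\<integral>z. h z \<partial>lebesgue_on (G ` ball 0 1))"
    if "integrable (lebesgue_on (G ` ball 0 1)) h" for h :: "complex \<Rightarrow> real"
    by (rule holomorphic_change_of_variables_real(2)[OF open_ball G'[OF subsetD[OF sub]] injG that])
  have vint: "(\<integral>z. v z * (cmod (q z))\<^sup>2 \<partial>disc) = (\<integral>z. \<phi> z \<partial>lebesgue_on \<Omega>)"
  proof -
    have "(\<integral>z. v z * (cmod (q z))\<^sup>2 \<partial>disc) = (\<integral>z. (cmod (q z))\<^sup>2 * \<phi> (G z) \<partial>disc)"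
      by (rule Bochner_Integration.integral_cong) (auto simp: v_def)
    also have "\<dots> = (\<integral>z. \<phi> z \<partial>lebesgue_on (G ` ball 0 1))"
      by (intro change lebesgue_on_supported(1)[OF test_function_continuous[OF \<phi>] K(1) K(3) KG GL])
    also have "\<dots> = (\<integral>z. \<phi> z \<partial>lebesgue_on \<Omega>)"
      using lebesgue_on_supported(2)[OF test_function_continuous[OF \<phi>] K(1) K(3) KG GL]
        lebesgue_on_supported(2)[OF test_function_continuous[OF \<phi>] K(1) K(3) K(2) OL] by simp
    finally show ?thesis .
  qed
  have contn: "continuous_on UNIV (\<lambda>z. (cmod (grad \<phi> z))\<^sup>2)"
    by (intro continuous_intros test_function_continuous_grad[OF \<phi>])
  have n0: "(cmod (grad \<phi> z))\<^sup>2 = 0" if "z \<notin> K" for z using K(4)[OF that] by simp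
  have gint: "(\<integral>z. (cmod (Complex (v' z 1) (v' z \<i>)))\<^sup>2 \<partial>disc) = (L2_norm \<Omega> (grad \<phi>))\<^sup>2"
  proof -
    have "(\<integral>z. (cmod (Complex (v' z 1) (v' z \<i>)))\<^sup>2 \<partial>disc) = (\<integral>z. (cmod (q z))\<^sup>2 * (cmod (grad \<phi> (G z)))\<^sup>2 \<partial>disc)"
    proof (rule Bochner_Integration.integral_cong)
      fix z assume "z \<in> space disc"
      then have "z \<in> ball 0 1" by simp
      then show "(cmod (Complex (v' z 1) (v' z \<i>)))\<^sup>2 = (cmod (q z))\<^sup>2 * (cmod (grad \<phi> (G z)))\<^sup>2"
        unfolding v'_def by (simp add: cmod_power2 inner_complex_def) (simp add: power2_eq_square algebra_simps)
    qed simp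
    also have "\<dots> = (\<integral>z. (cmod (grad \<phi> z))\<^sup>2 \<partial>lebesgue_on (G ` ball 0 1))"
      by (intro change lebesgue_on_supported(1)[OF contn K(1) n0 KG GL])
    also have "\<dots> = (\<integral>z. (cmod (grad \<phi> z))\<^sup>2 \<partial>lebesgue_on \<Omega>)"
      using lebesgue_on_supported(2)[OF contn K(1) n0 KG GL]
        lebesgue_on_supported(2)[OF contn K(1) n0 K(2) OL] by simp
    finally show ?thesis by (simp add: L2_norm_def)
  qed
  have area: "(\<integral>z. (cmod (q z))\<^sup>2 \<partial>disc) \<le> measure lebesgue \<Omega>"
  proof -
    have fin: "\<Omega> \<in> lmeasurable" using \<Omega> by (simp add: lmeasurable_open)
    have fin': "G ` ball 0 1 \<in> lmeasurable"
      using bounded_subset[OF \<Omega>(3) GD] openG by (rule lmeasurable_open)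
    have "integrable lebesgue (indicat_real (G ` ball 0 1))"
      using fin' by (intro integrable_real_indicator) (auto simp: fmeasurable_def)
    then have "integrable (lebesgue_on (G ` ball 0 1)) (\<lambda>_. 1::real)"
      using GL by (simp add: integrable_restrict_space)
    then have "(\<integral>z. (cmod (q z))\<^sup>2 \<partial>disc) = measure lebesgue (G ` ball 0 1)"
      using change[of "\<lambda>_. 1"] GL by (simp add: measure_restrict_space)
    also have "\<dots> \<le> measure lebesgue \<Omega>" by (rule measure_mono_fmeasurable[OF GD GL fin])
    finally show ?thesis .
  qed
  have L: "0 \<le> L2_norm \<Omega> (grad \<phi>)" by (simp add: L2_norm_def)
  have "\<bar>\<integral>z. \<phi> z \<partial>lebesgue_on \<Omega>\<bar> \<le> L2_norm \<Omega> (grad \<phi>) * (\<integral>z. (cmod (q z))\<^sup>2 \<partial>disc) / sqrt (8 * pi)"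
    using est unfolding vint gint using L by simp
  also have "\<dots> \<le> L2_norm \<Omega> (grad \<phi>) * measure lebesgue \<Omega> / sqrt (8 * pi)"
    using L area by (intro divide_right_mono mult_left_mono) auto
  finally show ?thesis by (simp add: mult.commute)
qed

section \<open>Square-integrable functions\<close>

lemma L2_norm_nonneg: "0 \<le> L2_norm \<Omega> f" by (simp add: L2_norm_def)

lemma L2_norm_power2: "(L2_norm \<Omega> f)\<^sup>2 = (\<integral>z. (norm (f z))\<^sup>2 \<partial>lebesgue_on \<Omega>)"
  by (simp add: L2_norm_def)

lemma square_integrable_scale:
  fixes f :: "complex \<Rightarrow> 'b::{banach, second_countable_topology}"
  assumes "square_integrable \<Omega> f"
  shows "square_integrable \<Omega> (\<lambda>z. c *\<^sub>R f z)"
  using assms unfolding square_integrable_def by (auto simp: power_mult_distrib)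

lemma L2_norm_scale: "L2_norm \<Omega> (\<lambda>z. c *\<^sub>R f z) = \<bar>c\<bar> * L2_norm \<Omega> f"
  by (simp add: L2_norm_def power_mult_distrib real_sqrt_mult)

lemma square_integrable_add:
  fixes f g :: "complex \<Rightarrow> 'b::{banach, second_countable_topology}"
  assumes f: "square_integrable \<Omega> f" and g: "square_integrable \<Omega> g"
  shows "square_integrable \<Omega> (\<lambda>z. f z + g z)"
proof -
  have [measurable]: "f \<in> borel_measurable (lebesgue_on \<Omega>)" "g \<in> borel_measurable (lebesgue_on \<Omega>)"
    using f g by (auto simp: square_integrable_def)
  have "(norm (f z + g z))\<^sup>2 \<le> 2 * (norm (f z))\<^sup>2 + 2 * (norm (g z))\<^sup>2" for z
  proof -
    have "(norm (f z + g z))\<^sup>2 \<le> (norm (f z) + norm (g z))\<^sup>2"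
      by (intro power_mono norm_triangle_ineq) auto
    also have "\<dots> \<le> 2 * (norm (f z))\<^sup>2 + 2 * (norm (g z))\<^sup>2"
      using sum_squares_bound[of "norm (f z)" "norm (g z)"] by (simp add: power2_sum)
    finally show ?thesis .
  qed
  note le = this
  have "integrable (lebesgue_on \<Omega>) (\<lambda>z. 2 * (norm (f z))\<^sup>2 + 2 * (norm (g z))\<^sup>2)"
    using f g unfolding square_integrable_def
    by (intro Bochner_Integration.integrable_add integrable_mult_right) blast+
  then have "integrable (lebesgue_on \<Omega>) (\<lambda>z. (norm (f z + g z))\<^sup>2)"
    by (rule Bochner_Integration.integrable_bound) (measurable, intro AE_I2, simp add: le)
  then show ?thesis by (simp add: square_integrable_def)
qed

lemma square_integrable_diff:
  fixes f g :: "complex \<Rightarrow> 'b::{banach, second_countable_topology}"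
  assumes f: "square_integrable \<Omega> f" and g: "square_integrable \<Omega> g"
  shows "square_integrable \<Omega> (\<lambda>z. f z - g z)"
  using square_integrable_add[OF f square_integrable_scale[OF g, of "-1"]] by simp

text \<open>Stated for bilinear products in general because both the real inner product of gradients and the
  product of a function with a gradient occur in the definition of weak solutions.\<close>

lemma square_integrable_bilinear:
  fixes f :: "complex \<Rightarrow> 'b::{banach, second_countable_topology}"
    and g :: "complex \<Rightarrow> 'c::{banach, second_countable_topology}"
    and prod :: "'b \<Rightarrow> 'c \<Rightarrow> 'd::{banach, second_countable_topology}"
  assumes prod: "bounded_bilinear prod" and le: "\<And>a b. norm (prod a b) \<le> norm a * norm b"
    and f: "square_integrable \<Omega> f" and g: "square_integrable \<Omega> g"
  shows "integrable (lebesgue_on \<Omega>) (\<lambda>z. prod (f z) (g z))"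
    and "norm (\<integral>z. prod (f z) (g z) \<partial>lebesgue_on \<Omega>) \<le> L2_norm \<Omega> f * L2_norm \<Omega> g"
proof -
  have m[measurable]: "f \<in> borel_measurable (lebesgue_on \<Omega>)" "g \<in> borel_measurable (lebesgue_on \<Omega>)"
    using f g by (auto simp: square_integrable_def)
  have "continuous_on UNIV (\<lambda>p. prod (fst p) (snd p))"
    by (intro bounded_bilinear.continuous_on[OF prod] continuous_intros)
  then have meas: "(\<lambda>z. prod (f z) (g z)) \<in> borel_measurable (lebesgue_on \<Omega>)"
    using borel_measurable_continuous_Pair[OF m, of prod] by (simp add: case_prod_unfold)
  have CS: "integrable (lebesgue_on \<Omega>) (\<lambda>z. norm (f z) * norm (g z))"
    "(\<integral>z. norm (f z) * norm (g z) \<partial>lebesgue_on \<Omega>) \<le> L2_norm \<Omega> f * L2_norm \<Omega> g"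
    using L2_Cauchy_Schwarz[OF m] f g by (auto simp: square_integrable_def L2_norm_def)
  show int: "integrable (lebesgue_on \<Omega>) (\<lambda>z. prod (f z) (g z))"
    by (rule Bochner_Integration.integrable_bound[OF CS(1) meas]) (auto intro!: AE_I2 le)
  have "norm (\<integral>z. prod (f z) (g z) \<partial>lebesgue_on \<Omega>) \<le> (\<integral>z. norm (prod (f z) (g z)) \<partial>lebesgue_on \<Omega>)"
    by (rule integral_norm_bound)
  also have "\<dots> \<le> (\<integral>z. norm (f z) * norm (g z) \<partial>lebesgue_on \<Omega>)"
    using int CS(1) by (intro integral_mono integrable_norm le)
  finally show "norm (\<integral>z. prod (f z) (g z) \<partial>lebesgue_on \<Omega>) \<le> L2_norm \<Omega> f * L2_norm \<Omega> g"
    using CS(2) by linarith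
qed

lemma norm_inner_le: "norm (a \<bullet> b) \<le> norm a * norm b" for a b :: "'a::real_inner"
  using Cauchy_Schwarz_ineq2[of a b] by simp

lemmas square_integrable_inner = square_integrable_bilinear[OF bounded_bilinear_inner norm_inner_le]

lemma L2_norm_eq_inner:
  fixes f :: "complex \<Rightarrow> 'b::euclidean_space"
  shows "(L2_norm \<Omega> f)\<^sup>2 = (\<integral>z. f z \<bullet> f z \<partial>lebesgue_on \<Omega>)"
  unfolding L2_norm_power2 by (simp add: power2_norm_eq_inner)

lemma L2_norm_add_power2:
  fixes f g :: "complex \<Rightarrow> 'b::euclidean_space"
  assumes f: "square_integrable \<Omega> f" and g: "square_integrable \<Omega> g"
  shows "(L2_norm \<Omega> (\<lambda>z. f z + g z))\<^sup>2
     = (L2_norm \<Omega> f)\<^sup>2 + 2 * (\<integral>z. f z \<bullet> g z \<partial>lebesgue_on \<Omega>) + (L2_norm \<Omega> g)\<^sup>2"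
proof -
  have "(f z + g z) \<bullet> (f z + g z) = f z \<bullet> f z + 2 * (f z \<bullet> g z) + g z \<bullet> g z" for z
    by (simp add: inner_add inner_commute)
  then show ?thesis
    using square_integrable_inner(1)[OF f f] square_integrable_inner(1)[OF f g] square_integrable_inner(1)[OF g g]
    by (simp add: L2_norm_eq_inner)
qed

lemma L2_norm_triangle:
  fixes f g :: "complex \<Rightarrow> 'b::euclidean_space"
  assumes f: "square_integrable \<Omega> f" and g: "square_integrable \<Omega> g"
  shows "L2_norm \<Omega> (\<lambda>z. f z + g z) \<le> L2_norm \<Omega> f + L2_norm \<Omega> g"
proof (rule power2_le_imp_le)
  show "(L2_norm \<Omega> (\<lambda>z. f z + g z))\<^sup>2 \<le> (L2_norm \<Omega> f + L2_norm \<Omega> g)\<^sup>2"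
    using square_integrable_inner(2)[OF f g]
    by (simp add: L2_norm_add_power2[OF f g] power2_sum)
qed (simp add: L2_norm_nonneg)

lemma L2_norm_minus_commute: "L2_norm \<Omega> (\<lambda>z. f z - g z) = L2_norm \<Omega> (\<lambda>z. g z - f z)"
  by (simp add: L2_norm_def norm_minus_commute)

lemma L2_norm_tendsto:
  fixes f :: "complex \<Rightarrow> 'b::euclidean_space"
  assumes f: "square_integrable \<Omega> f" and g: "\<And>n. square_integrable \<Omega> (g n)"
    and lim: "(\<lambda>n. L2_norm \<Omega> (\<lambda>z. f z - g n z)) \<longlonglongrightarrow> 0"
  shows "(\<lambda>n. L2_norm \<Omega> (g n)) \<longlonglongrightarrow> L2_norm \<Omega> f"
proof (rule LIM_zero_cancel, rule Lim_null_comparison[OF _ lim], rule always_eventually, rule allI)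
  fix n
  have "L2_norm \<Omega> (\<lambda>z. (f z - g n z) + g n z) \<le> L2_norm \<Omega> (\<lambda>z. f z - g n z) + L2_norm \<Omega> (g n)"
    by (rule L2_norm_triangle[OF square_integrable_diff[OF f g] g])
  moreover have "L2_norm \<Omega> (\<lambda>z. (g n z - f z) + f z) \<le> L2_norm \<Omega> (\<lambda>z. g n z - f z) + L2_norm \<Omega> f"
    by (rule L2_norm_triangle[OF square_integrable_diff[OF g f] f])
  ultimately show "norm (L2_norm \<Omega> (g n) - L2_norm \<Omega> f) \<le> L2_norm \<Omega> (\<lambda>z. f z - g n z)"
    using L2_norm_minus_commute[of \<Omega> f "g n"] by simp
qed

lemma L2_bilinear_tendsto:
  fixes f :: "complex \<Rightarrow> 'b::{banach, second_countable_topology}"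
    and g :: "complex \<Rightarrow> 'c::{banach, second_countable_topology}"
    and prod :: "'b \<Rightarrow> 'c \<Rightarrow> 'd::{banach, second_countable_topology}"
  assumes prod: "bounded_bilinear prod" and le: "\<And>a b. norm (prod a b) \<le> norm a * norm b"
    and f: "square_integrable \<Omega> f" "\<And>n. square_integrable \<Omega> (F n)" and g: "square_integrable \<Omega> g"
    and lim: "(\<lambda>n. L2_norm \<Omega> (\<lambda>z. f z - F n z)) \<longlonglongrightarrow> 0"
  shows "(\<lambda>n. \<integral>z. prod (F n z) (g z) \<partial>lebesgue_on \<Omega>) \<longlonglongrightarrow> (\<integral>z. prod (f z) (g z) \<partial>lebesgue_on \<Omega>)"
proof (rule LIM_zero_cancel, rule Lim_null_comparison)
  show "(\<lambda>n. L2_norm \<Omega> (\<lambda>z. f z - F n z) * L2_norm \<Omega> g) \<longlonglongrightarrow> 0"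
    using tendsto_mult_right[OF lim, of "L2_norm \<Omega> g"] by simp
  show "\<forall>\<^sub>F n in sequentially. norm ((\<integral>z. prod (F n z) (g z) \<partial>lebesgue_on \<Omega>) - (\<integral>z. prod (f z) (g z) \<partial>lebesgue_on \<Omega>))
      \<le> L2_norm \<Omega> (\<lambda>z. f z - F n z) * L2_norm \<Omega> g"
  proof (rule always_eventually, rule allI)
    fix n
    have "(\<integral>z. prod (F n z) (g z) \<partial>lebesgue_on \<Omega>) - (\<integral>z. prod (f z) (g z) \<partial>lebesgue_on \<Omega>)
        = (\<integral>z. prod (F n z - f z) (g z) \<partial>lebesgue_on \<Omega>)"
      unfolding bounded_bilinear.diff_left[OF prod]
      by (rule Bochner_Integration.integral_diff[symmetric];
          rule square_integrable_bilinear(1)[OF prod le _ g]; rule f)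
    also have "norm \<dots> \<le> L2_norm \<Omega> (\<lambda>z. F n z - f z) * L2_norm \<Omega> g"
      by (rule square_integrable_bilinear(2)[OF prod le square_integrable_diff[OF f(2) f(1)] g])
    finally show "norm ((\<integral>z. prod (F n z) (g z) \<partial>lebesgue_on \<Omega>) - (\<integral>z. prod (f z) (g z) \<partial>lebesgue_on \<Omega>))
      \<le> L2_norm \<Omega> (\<lambda>z. f z - F n z) * L2_norm \<Omega> g"
      by (simp add: L2_norm_minus_commute[of \<Omega> f])
  qed
qed

lemmas L2_inner_tendsto = L2_bilinear_tendsto[OF bounded_bilinear_inner norm_inner_le]
lemmas L2_scaleR_tendsto = L2_bilinear_tendsto[OF bounded_bilinear_scaleR eq_refl[OF norm_scaleR[folded real_norm_def]]]

lemma square_integrable_const: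
  fixes c :: "'b::{banach, second_countable_topology}"
  assumes "\<Omega> \<in> lmeasurable"
  shows "square_integrable \<Omega> (\<lambda>_. c)"
proof -
  have "integrable lebesgue (indicat_real \<Omega>)"
    using assms by (intro integrable_real_indicator) (auto simp: fmeasurable_def)
  then have "integrable (lebesgue_on \<Omega>) (\<lambda>_. 1::real)"
    using assms by (simp add: integrable_restrict_space fmeasurableD)
  then have "integrable (lebesgue_on \<Omega>) (\<lambda>_. (norm c)\<^sup>2 * 1)"
    by (rule integrable_mult_right)
  then show ?thesis by (simp add: square_integrable_def)
qed

text \<open>On a set of finite measure an \<open>L\<^sup>2\<close> Cauchy sequence is Cauchy in \<open>L\<^sup>1\<close>, hence has a subsequence
  that converges almost everywhere; Fatou's lemma turns the pointwise limit into an \<open>L\<^sup>2\<close> limit of the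
  whole sequence.\<close>

theorem L2_complete:
  fixes f :: "nat \<Rightarrow> complex \<Rightarrow> 'b::euclidean_space"
  assumes \<Omega>: "\<Omega> \<in> lmeasurable" and f: "\<And>n. square_integrable \<Omega> (f n)"
    and cauchy: "\<And>e. e > 0 \<Longrightarrow> \<exists>N. \<forall>i\<ge>N. \<forall>j\<ge>N. L2_norm \<Omega> (\<lambda>z. f i z - f j z) < e"
  obtains u where "square_integrable \<Omega> u" "(\<lambda>n. L2_norm \<Omega> (\<lambda>z. u z - f n z)) \<longlonglongrightarrow> 0"
proof -
  let ?M = "lebesgue_on \<Omega>"
  have one: "square_integrable \<Omega> (\<lambda>_. 1::real)" using \<Omega> by (rule square_integrable_const)
  have int: "integrable ?M g" "(\<integral>z. norm (g z) \<partial>?M) \<le> L2_norm \<Omega> g * L2_norm \<Omega> (\<lambda>_. 1::real)"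
    if g: "square_integrable \<Omega> g" for g :: "complex \<Rightarrow> 'b"
  proof -
    have "integrable ?M (\<lambda>z. norm (g z) * norm (1::real))"
      "(\<integral>z. norm (g z) * norm (1::real) \<partial>?M) \<le> L2_norm \<Omega> g * L2_norm \<Omega> (\<lambda>_. 1::real)"
      using L2_Cauchy_Schwarz[of g ?M "\<lambda>_. 1::real"] g one by (auto simp: square_integrable_def L2_norm_def)
    then show "integrable ?M g" "(\<integral>z. norm (g z) \<partial>?M) \<le> L2_norm \<Omega> g * L2_norm \<Omega> (\<lambda>_. 1::real)"
      using g by (auto simp: square_integrable_def integrable_norm_iff)
  qed
  have [measurable]: "f n \<in> borel_measurable ?M" for n using f by (simp add: square_integrable_def)
  have L1: "\<exists>N. \<forall>i\<ge>N. \<forall>j\<ge>N. (\<integral>z. norm (f i z - f j z) \<partial>?M) < e" if e: "e > 0" for e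
  proof -
    define c where "c = L2_norm \<Omega> (\<lambda>_. 1::real) + 1"
    have c: "c > 0" using L2_norm_nonneg[of \<Omega> "\<lambda>_. 1::real"] by (simp add: c_def)
    obtain N where N: "\<And>i j. i \<ge> N \<Longrightarrow> j \<ge> N \<Longrightarrow> L2_norm \<Omega> (\<lambda>z. f i z - f j z) < e / c"
      using cauchy[of "e / c"] e c by (meson divide_pos_pos)
    have "(\<integral>z. norm (f i z - f j z) \<partial>?M) < e" if "i \<ge> N" "j \<ge> N" for i j
    proof -
      have "(\<integral>z. norm (f i z - f j z) \<partial>?M) \<le> L2_norm \<Omega> (\<lambda>z. f i z - f j z) * L2_norm \<Omega> (\<lambda>_. 1::real)"
        by (rule int(2)[OF square_integrable_diff[OF f f]])
      also have "\<dots> \<le> L2_norm \<Omega> (\<lambda>z. f i z - f j z) * c"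
        by (intro mult_left_mono) (auto simp: c_def L2_norm_nonneg)
      also have "\<dots> < e" using N[OF that] c by (simp add: field_simps)
      finally show ?thesis .
    qed
    then show ?thesis by blast
  qed
  obtain r where r: "strict_mono r" "AE z in ?M. Cauchy (\<lambda>i. f (r i) z)"
    by (rule cauchy_L1_AE_cauchy_subseq[of ?M f]) (use int(1)[OF f] L1 in auto)
  define u where "u z = lim (\<lambda>i. f (r i) z)" for z
  have u[measurable]: "u \<in> borel_measurable ?M" unfolding u_def by measurable
  have lim: "AE z in ?M. (\<lambda>i. f (r i) z) \<longlonglongrightarrow> u z"
    using r(2) by eventually_elim (auto simp: u_def Cauchy_convergent_iff convergent_LIMSEQ_iff)
  have fatou: "(\<integral>\<^sup>+z. ennreal ((norm (u z - f n z))\<^sup>2) \<partial>?M) \<le> ennreal (e\<^sup>2)"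
    if bound: "\<And>i. i \<ge> N \<Longrightarrow> L2_norm \<Omega> (\<lambda>z. f i z - f n z) \<le> e" for n e N
  proof -
    have "(\<integral>\<^sup>+z. ennreal ((norm (u z - f n z))\<^sup>2) \<partial>?M)
        = (\<integral>\<^sup>+z. liminf (\<lambda>i. ennreal ((norm (f (r i) z - f n z))\<^sup>2)) \<partial>?M)"
    proof (rule nn_integral_cong_AE)
      show "AE z in ?M. ennreal ((norm (u z - f n z))\<^sup>2) = liminf (\<lambda>i. ennreal ((norm (f (r i) z - f n z))\<^sup>2))"
        using lim
      proof eventually_elim
        case (elim z)
        then have "(\<lambda>i. ennreal ((norm (f (r i) z - f n z))\<^sup>2)) \<longlonglongrightarrow> ennreal ((norm (u z - f n z))\<^sup>2)"
          by (intro tendsto_intros tendsto_ennrealI)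
        then show ?case by (rule lim_imp_Liminf[OF trivial_limit_sequentially, symmetric])
      qed
    qed
    also have "\<dots> \<le> liminf (\<lambda>i. \<integral>\<^sup>+z. ennreal ((norm (f (r i) z - f n z))\<^sup>2) \<partial>?M)"
      by (rule nn_integral_liminf) measurable
    also have "\<dots> \<le> ennreal (e\<^sup>2)"
    proof (rule Liminf_le)
      show "\<forall>\<^sub>F i in sequentially. (\<integral>\<^sup>+z. ennreal ((norm (f (r i) z - f n z))\<^sup>2) \<partial>?M) \<le> ennreal (e\<^sup>2)"
        unfolding eventually_sequentially
      proof (intro exI allI impI)
        fix i assume "i \<ge> N"
        then have "r i \<ge> N" using seq_suble[OF r(1), of i] by simp
        have "(\<integral>\<^sup>+z. ennreal ((norm (f (r i) z - f n z))\<^sup>2) \<partial>?M) = ennreal ((L2_norm \<Omega> (\<lambda>z. f (r i) z - f n z))\<^sup>2)"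
          unfolding L2_norm_power2
          by (rule nn_integral_eq_integral) (use square_integrable_diff[OF f f] in \<open>auto simp: square_integrable_def\<close>)
        also have "\<dots> \<le> ennreal (e\<^sup>2)"
          using bound[OF \<open>r i \<ge> N\<close>] by (intro ennreal_leI power_mono) (auto simp: L2_norm_nonneg)
        finally show "(\<integral>\<^sup>+z. ennreal ((norm (f (r i) z - f n z))\<^sup>2) \<partial>?M) \<le> ennreal (e\<^sup>2)" .
      qed
    qed simp
    finally show ?thesis .
  qed
  have close: "square_integrable \<Omega> (\<lambda>z. u z - f n z) \<and> L2_norm \<Omega> (\<lambda>z. u z - f n z) \<le> e"
    if "\<And>i. i \<ge> N \<Longrightarrow> L2_norm \<Omega> (\<lambda>z. f i z - f n z) \<le> e" "e \<ge> 0" for n e N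
  proof -
    have le: "(\<integral>\<^sup>+z. ennreal ((norm (u z - f n z))\<^sup>2) \<partial>?M) \<le> ennreal (e\<^sup>2)" using fatou that(1) by blast
    have i: "integrable ?M (\<lambda>z. (norm (u z - f n z))\<^sup>2)"
      by (rule integrableI_bounded, measurable) (use le_less_trans[OF le ennreal_less_top] in simp)
    have "ennreal ((L2_norm \<Omega> (\<lambda>z. u z - f n z))\<^sup>2) \<le> ennreal (e\<^sup>2)"
      unfolding L2_norm_power2 using le nn_integral_eq_integral[OF i] by simp
    then have "(L2_norm \<Omega> (\<lambda>z. u z - f n z))\<^sup>2 \<le> e\<^sup>2" by simp
    then have "L2_norm \<Omega> (\<lambda>z. u z - f n z) \<le> e" using that(2) by (rule power2_le_imp_le)
    then show ?thesis using i by (simp add: square_integrable_def)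
  qed
  have ev: "\<exists>N. \<forall>n\<ge>N. square_integrable \<Omega> (\<lambda>z. u z - f n z) \<and> L2_norm \<Omega> (\<lambda>z. u z - f n z) \<le> e"
    if e: "e > 0" for e
  proof -
    obtain N where N: "\<And>i j. i \<ge> N \<Longrightarrow> j \<ge> N \<Longrightarrow> L2_norm \<Omega> (\<lambda>z. f i z - f j z) < e"
      using cauchy[OF e] by blast
    have "square_integrable \<Omega> (\<lambda>z. u z - f n z) \<and> L2_norm \<Omega> (\<lambda>z. u z - f n z) \<le> e" if "n \<ge> N" for n
      by (rule close[of N]) (use N[OF _ that] e in \<open>auto intro: less_imp_le\<close>)
    then show ?thesis by blast
  qed
  show thesis
  proof
    obtain n where "square_integrable \<Omega> (\<lambda>z. u z - f n z)" using ev[of 1] by auto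
    from square_integrable_add[OF this f[of n]] show "square_integrable \<Omega> u" by simp
    show "(\<lambda>n. L2_norm \<Omega> (\<lambda>z. u z - f n z)) \<longlonglongrightarrow> 0"
    proof (rule LIMSEQ_I)
      fix e :: real assume "e > 0"
      then obtain N where N: "\<forall>n\<ge>N. L2_norm \<Omega> (\<lambda>z. u z - f n z) \<le> e / 2" using ev[of "e / 2"] by auto
      then show "\<exists>N. \<forall>n\<ge>N. norm (L2_norm \<Omega> (\<lambda>z. u z - f n z) - 0) < e"
      proof (intro exI[of _ N] allI impI)
        fix n assume "N \<le> n"
        then have "L2_norm \<Omega> (\<lambda>z. u z - f n z) \<le> e / 2" using N by blast
        then show "norm (L2_norm \<Omega> (\<lambda>z. u z - f n z) - 0) < e"
          using \<open>e > 0\<close> L2_norm_nonneg[of \<Omega> "\<lambda>z. u z - f n z"] by simp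
      qed
    qed
  qed
qed

section \<open>Integration by parts for test functions\<close>

lemma continuously_differentiable_linear_combination:
  assumes "continuously_differentiable k f" "continuously_differentiable k g"
  shows "continuously_differentiable k (\<lambda>z. c * f z + d * g z)"
  using assms
proof (induction k arbitrary: f g)
  case 0
  then show ?case by (auto intro!: continuous_intros)
next
  case (Suc k)
  have der: "((\<lambda>z. c * f z + d * g z) has_derivative
      (\<lambda>h. c * frechet_derivative f (at z) h + d * frechet_derivative g (at z) h)) (at z)" for z
    using Suc.prems frechet_derivative_works by (intro has_derivative_add has_derivative_mult_right) auto
  then have "frechet_derivative (\<lambda>z. c * f z + d * g z) (at z)
      = (\<lambda>h. c * frechet_derivative f (at z) h + d * frechet_derivative g (at z) h)" for z
    using frechet_derivative_at by metis
  moreover have "(\<lambda>z. c * f z + d * g z) differentiable (at z)" for z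
    using der differentiable_def by blast
  ultimately show ?case
    using Suc by simp
qed

lemma test_function_linear_combination:
  assumes f: "test_function \<Omega> f" and g: "test_function \<Omega> g"
  shows "test_function \<Omega> (\<lambda>z. c * f z + d * g z)"
    and "grad (\<lambda>z. c * f z + d * g z) = (\<lambda>z. c *\<^sub>R grad f z + d *\<^sub>R grad g z)"
proof -
  have "{z. c * f z + d * g z \<noteq> 0} \<subseteq> {z. f z \<noteq> 0} \<union> {z. g z \<noteq> 0}" by auto
  then have sub: "closure {z. c * f z + d * g z \<noteq> 0} \<subseteq> closure {z. f z \<noteq> 0} \<union> closure {z. g z \<noteq> 0}"
    unfolding closure_Un[symmetric] by (rule closure_mono)
  have "compact (closure {z. f z \<noteq> 0} \<union> closure {z. g z \<noteq> 0})"
    using f g by (simp add: test_function_def compact_Un)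
  from compact_Int_closed[OF this closed_closure[of "{z. c * f z + d * g z \<noteq> 0}"]]
  have "compact (closure {z. c * f z + d * g z \<noteq> 0})"
    using sub by (simp only: inf.absorb2)
  moreover have "continuously_differentiable k (\<lambda>z. c * f z + d * g z)" for k
    using f g by (intro continuously_differentiable_linear_combination) (auto simp: test_function_def)
  moreover have "closure {z. c * f z + d * g z \<noteq> 0} \<subseteq> \<Omega>"
    using sub f g by (auto simp: test_function_def)
  ultimately show "test_function \<Omega> (\<lambda>z. c * f z + d * g z)"
    unfolding test_function_def by blast
  then have t: "((\<lambda>z. c * f z + d * g z) has_derivative (\<lambda>h. grad (\<lambda>z. c * f z + d * g z) z \<bullet> h)) (at z)" for z
    by (rule test_function_has_derivative)
  have t': "((\<lambda>z. c * f z + d * g z) has_derivative (\<lambda>h. (c *\<^sub>R grad f z + d *\<^sub>R grad g z) \<bullet> h)) (at z)" for z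
    by (rule has_derivative_eq_rhs[OF has_derivative_add[OF
          has_derivative_mult_right[OF test_function_has_derivative[OF f]]
          has_derivative_mult_right[OF test_function_has_derivative[OF g]]]])
      (simp add: inner_add_left)
  show "grad (\<lambda>z. c * f z + d * g z) = (\<lambda>z. c *\<^sub>R grad f z + d *\<^sub>R grad g z)"
  proof
    fix z
    have "grad (\<lambda>z. c * f z + d * g z) z \<bullet> h = (c *\<^sub>R grad f z + d *\<^sub>R grad g z) \<bullet> h" for h
      using fun_cong[OF has_derivative_unique[OF t t']] .
    then show "grad (\<lambda>z. c * f z + d * g z) z = c *\<^sub>R grad f z + d *\<^sub>R grad g z"
      by (rule vector_eq_rdot[THEN iffD1, OF allI])
  qed
qed

lemma test_function_zero: "test_function \<Omega> (\<lambda>_. 0)"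
proof -
  have "continuously_differentiable k (\<lambda>_. 0)" for k
    by (induction k) auto
  then show ?thesis by (simp add: test_function_def)
qed

lemma test_function_square_integrable:
  assumes \<phi>: "test_function \<Omega> \<phi>" and \<Omega>: "\<Omega> \<in> sets lebesgue"
  shows "square_integrable \<Omega> \<phi>" and "square_integrable \<Omega> (grad \<phi>)"
proof -
  obtain K where K: "compact K" "K \<subseteq> \<Omega>" "\<And>z. z \<notin> K \<Longrightarrow> \<phi> z = 0" "\<And>z. z \<notin> K \<Longrightarrow> grad \<phi> z = 0"
    using test_function_support[OF \<phi>] by blast
  note c = test_function_continuous[OF \<phi>] test_function_continuous_grad[OF \<phi>]
  have "integrable (lebesgue_on \<Omega>) (\<lambda>z. (norm (\<phi> z))\<^sup>2)" "integrable (lebesgue_on \<Omega>) (\<lambda>z. (norm (grad \<phi> z))\<^sup>2)"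
    by (rule lebesgue_on_supported(1)[OF _ K(1) _ K(2) \<Omega>]; (intro continuous_intros c)?; simp add: K)+
  moreover have "integrable (lebesgue_on \<Omega>) \<phi>" "integrable (lebesgue_on \<Omega>) (grad \<phi>)"
    by (rule lebesgue_on_supported(1)[OF _ K(1) _ K(2) \<Omega>]; (intro c)?; simp add: K)+
  ultimately show "square_integrable \<Omega> \<phi>" "square_integrable \<Omega> (grad \<phi>)"
    by (auto simp: square_integrable_def)
qed

lemma test_function_integration_by_parts:
  assumes \<phi>: "test_function \<Omega> \<phi>" and \<psi>: "test_function \<Omega> \<psi>" and \<Omega>: "\<Omega> \<in> sets lebesgue"
  shows "(\<integral>z. \<phi> z *\<^sub>R grad \<psi> z \<partial>lebesgue_on \<Omega>) = - (\<integral>z. \<psi> z *\<^sub>R grad \<phi> z \<partial>lebesgue_on \<Omega>)"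
proof -
  obtain K where K: "compact K" "K \<subseteq> \<Omega>" "\<And>z. z \<notin> K \<Longrightarrow> \<phi> z = 0" "\<And>z. z \<notin> K \<Longrightarrow> grad \<phi> z = 0"
    using test_function_support[OF \<phi>] by blast
  note c = test_function_continuous[OF \<phi>] test_function_continuous_grad[OF \<phi>]
    test_function_continuous[OF \<psi>] test_function_continuous_grad[OF \<psi>]
  let ?F = "\<lambda>z. \<phi> z *\<^sub>R grad \<psi> z + \<psi> z *\<^sub>R grad \<phi> z"
  have contF: "continuous_on UNIV ?F" by (intro continuous_intros c)
  have int: "integrable (lebesgue_on \<Omega>) (\<lambda>z. \<phi> z *\<^sub>R grad \<psi> z)" "integrable (lebesgue_on \<Omega>) (\<lambda>z. \<psi> z *\<^sub>R grad \<phi> z)"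
    "integrable (lebesgue_on \<Omega>) ?F"
    by (rule lebesgue_on_supported(1)[OF _ K(1) _ K(2) \<Omega>]; (intro continuous_intros c)?; simp add: K)+
  have "(\<integral>z. ?F z \<partial>lebesgue_on \<Omega>) \<bullet> e = 0" for e
  proof -
    have "(\<integral>z. ?F z \<partial>lebesgue_on \<Omega>) \<bullet> e = (\<integral>z. ?F z \<bullet> e \<partial>lebesgue_on \<Omega>)"
      by (rule integral_inner_left[symmetric]) (rule int)
    also have "\<dots> = (\<integral>z. ?F z \<bullet> e \<partial>lborel)"
      by (rule lebesgue_on_supported(2)[OF _ K(1) _ K(2) \<Omega>]; (intro continuous_intros c)?; simp add: K)
    also have "\<dots> = 0"
    proof (rule integral_directional_derivative_eq_0[where \<psi>="\<lambda>z. \<phi> z * \<psi> z" and \<psi>'="\<lambda>z h. ?F z \<bullet> h", OF _ _ K(1)])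
      show "((\<lambda>z. \<phi> z * \<psi> z) has_derivative (\<lambda>h. ?F z \<bullet> h)) (at z)" for z
        by (rule has_derivative_eq_rhs[OF has_derivative_mult[OF test_function_has_derivative[OF \<phi>] test_function_has_derivative[OF \<psi>]]])
          (simp add: inner_add_left mult.commute)
      show "continuous_on UNIV (\<lambda>z. ?F z \<bullet> e)" by (intro continuous_intros c)
    qed (simp add: K)
    finally show ?thesis .
  qed
  then have "(\<integral>z. ?F z \<partial>lebesgue_on \<Omega>) = 0" by (metis inner_eq_zero_iff)
  then show ?thesis using int by (simp add: eq_neg_iff_add_eq_0)
qed

text \<open>The derivative of \<open>Re z * (\<phi> z)\<^sup>2\<close> in the real direction integrates to zero, which expresses the
  integral of \<open>\<phi>\<^sup>2\<close> by \<open>-2 * Re z * \<phi> * \<partial>\<phi> / \<partial>x\<close>; half of it is absorbed by the arithmetic-geometric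
  mean inequality.\<close>

lemma Poincare_inequality:
  assumes \<phi>: "test_function \<Omega> \<phi>" and \<Omega>: "\<Omega> \<in> sets lebesgue" "\<Omega> \<subseteq> ball 0 R"
  shows "L2_norm \<Omega> \<phi> \<le> 2 * R * L2_norm \<Omega> (grad \<phi>)"
proof (cases "\<Omega> = {}")
  case True
  then show ?thesis by (simp add: L2_norm_def)
next
  case False
  then obtain w where "w \<in> \<Omega>" by blast
  then have "cmod w < R" using \<Omega>(2) by auto
  then have R: "R > 0" using norm_ge_zero[of w] by linarith
  obtain K where K: "compact K" "K \<subseteq> \<Omega>" "\<And>z. z \<notin> K \<Longrightarrow> \<phi> z = 0" "\<And>z. z \<notin> K \<Longrightarrow> grad \<phi> z = 0"
    using test_function_support[OF \<phi>] by blast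
  note c = test_function_continuous[OF \<phi>] test_function_continuous_grad[OF \<phi>]
  let ?M = "lebesgue_on \<Omega>"
  let ?D = "\<lambda>z. 2 * Re z * \<phi> z * Re (grad \<phi> z)"
  have int: "integrable ?M (\<lambda>z. (\<phi> z)\<^sup>2)" "integrable ?M ?D" "integrable ?M (\<lambda>z. (cmod (grad \<phi> z))\<^sup>2)"
    by (rule lebesgue_on_supported(1)[OF _ K(1) _ K(2) \<Omega>(1)]; (intro continuous_intros c)?; simp add: K)+
  have "(\<integral>z. (\<phi> z)\<^sup>2 + ?D z \<partial>?M) = (\<integral>z. (\<phi> z)\<^sup>2 + ?D z \<partial>lborel)"
    by (rule lebesgue_on_supported(2)[OF _ K(1) _ K(2) \<Omega>(1)]; (intro continuous_intros c)?; simp add: K)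
  also have "\<dots> = (\<integral>z. Re 1 * (\<phi> z)\<^sup>2 + 2 * Re z * \<phi> z * (grad \<phi> z \<bullet> 1) \<partial>lborel)"
    by (simp add: inner_complex_def)
  also have "\<dots> = 0"
  proof (rule integral_directional_derivative_eq_0[where \<psi>="\<lambda>z. Re z * (\<phi> z)\<^sup>2"
      and \<psi>'="\<lambda>z h. Re h * (\<phi> z)\<^sup>2 + 2 * Re z * \<phi> z * (grad \<phi> z \<bullet> h)", OF _ _ K(1)])
    show "((\<lambda>z. Re z * (\<phi> z)\<^sup>2) has_derivative (\<lambda>h. Re h * (\<phi> z)\<^sup>2 + 2 * Re z * \<phi> z * (grad \<phi> z \<bullet> h))) (at z)" for z
    proof (rule has_derivative_eq_rhs)
      show "((\<lambda>z. Re z * (\<phi> z)\<^sup>2) has_derivative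
          (\<lambda>h. Re z * (of_nat 2 * (grad \<phi> z \<bullet> h) * \<phi> z ^ (2 - 1)) + Re h * (\<phi> z)\<^sup>2)) (at z)"
        by (rule has_derivative_mult[OF bounded_linear_imp_has_derivative[OF bounded_linear_Re]
           has_derivative_power[OF test_function_has_derivative[OF \<phi>]]])
    qed (auto simp: fun_eq_iff)
    show "continuous_on UNIV (\<lambda>z. Re 1 * (\<phi> z)\<^sup>2 + 2 * Re z * \<phi> z * (grad \<phi> z \<bullet> 1))"
      by (intro continuous_intros c)
  qed (simp add: K)
  finally have "(\<integral>z. (\<phi> z)\<^sup>2 \<partial>?M) + (\<integral>z. ?D z \<partial>?M) = 0"
    using int by simp
  moreover have "- (\<integral>z. ?D z \<partial>?M) \<le> (\<integral>z. (\<phi> z)\<^sup>2 / 2 + 2 * R\<^sup>2 * (cmod (grad \<phi> z))\<^sup>2 \<partial>?M)"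
  proof -
    have "- (\<integral>z. ?D z \<partial>?M) = (\<integral>z. - ?D z \<partial>?M)" by simp
    also have "\<dots> \<le> (\<integral>z. (\<phi> z)\<^sup>2 / 2 + 2 * R\<^sup>2 * (cmod (grad \<phi> z))\<^sup>2 \<partial>?M)"
    proof (rule integral_mono)
      fix z assume "z \<in> space ?M"
      then have "cmod z \<le> R" using \<Omega> by auto
      then have "\<bar>Re z\<bar> \<le> R" using abs_Re_le_cmod[of z] by linarith
      moreover have "\<bar>Re (grad \<phi> z)\<bar> \<le> cmod (grad \<phi> z)" by (rule abs_Re_le_cmod)
      ultimately have "(Re z * Re (grad \<phi> z))\<^sup>2 \<le> (R * cmod (grad \<phi> z))\<^sup>2"
        by (intro power2_le_iff_abs_le[THEN iffD2]) (use R in \<open>auto simp: abs_mult intro!: mult_mono\<close>)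
      moreover have "0 \<le> (\<phi> z / 2 + Re z * Re (grad \<phi> z))\<^sup>2 * 2" by simp
      then have "- ?D z \<le> (\<phi> z)\<^sup>2 / 2 + 2 * (Re z * Re (grad \<phi> z))\<^sup>2"
        by (simp add: power2_eq_square algebra_simps)
      ultimately show "- ?D z \<le> (\<phi> z)\<^sup>2 / 2 + 2 * R\<^sup>2 * (cmod (grad \<phi> z))\<^sup>2"
        by (simp add: power_mult_distrib)
    qed (use int in auto)
    finally show ?thesis .
  qed
  moreover have "(\<integral>z. (\<phi> z)\<^sup>2 / 2 + 2 * R\<^sup>2 * (cmod (grad \<phi> z))\<^sup>2 \<partial>?M)
      = (\<integral>z. (\<phi> z)\<^sup>2 \<partial>?M) / 2 + 2 * R\<^sup>2 * (\<integral>z. (cmod (grad \<phi> z))\<^sup>2 \<partial>?M)"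
    using int by simp
  ultimately have "(\<integral>z. (\<phi> z)\<^sup>2 \<partial>?M) \<le> 4 * R\<^sup>2 * (\<integral>z. (cmod (grad \<phi> z))\<^sup>2 \<partial>?M)" by linarith
  then have "(L2_norm \<Omega> \<phi>)\<^sup>2 \<le> (2 * R * L2_norm \<Omega> (grad \<phi>))\<^sup>2"
    by (simp add: L2_norm_power2 power_mult_distrib)
  then show ?thesis
    by (rule power2_le_imp_le) (use R in \<open>simp add: L2_norm_nonneg\<close>)
qed

section \<open>Existence of the stress function and its energy\<close>

text \<open>Dirichlet's principle. The hypothesis bounds the energy \<open>E \<phi> = \<integral> \<bar>grad \<phi>\<bar>\<^sup>2 - 4 * \<integral> \<phi>\<close> from below;
  the factor \<open>4\<close> makes the Euler equation of \<open>E\<close> that of \<open>\<Delta>u = -2\<close>. The closure of the test functions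
  is by definition the space in which the solution lies, so the limit of a minimising sequence of
  test functions is directly of the required kind.\<close>

lemma stress_function_exists:
  assumes \<Omega>: "open \<Omega>" "bounded \<Omega>"
    and coercive: "\<And>\<phi>. test_function \<Omega> \<phi> \<Longrightarrow> \<bar>\<integral>z. \<phi> z \<partial>lebesgue_on \<Omega>\<bar> \<le> C * L2_norm \<Omega> (grad \<phi>)"
  shows "\<exists>u G. stress_function \<Omega> u G"
proof -
  have m: "\<Omega> \<in> lmeasurable" and s: "\<Omega> \<in> sets lebesgue" using \<Omega> by (auto simp: lmeasurable_open)
  obtain R where R: "\<Omega> \<subseteq> ball 0 R" "R > 0" using \<Omega>(2) bounded_subset_ballD by blast
  note sq = test_function_square_integrable[OF _ s]
  let ?I = "\<lambda>\<phi>. \<integral>z. \<phi> z \<partial>lebesgue_on \<Omega>"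
  have one: "square_integrable \<Omega> (\<lambda>_. 1::real)" by (rule square_integrable_const[OF m])
  have int: "integrable (lebesgue_on \<Omega>) \<phi>" if "square_integrable \<Omega> \<phi>" for \<phi> :: "complex \<Rightarrow> real"
    using square_integrable_inner(1)[OF that one] by simp
  define E where "E \<phi> = (L2_norm \<Omega> (grad \<phi>))\<^sup>2 - 4 * ?I \<phi>" for \<phi>
  have below: "- 4 * C\<^sup>2 \<le> E \<phi>" if "test_function \<Omega> \<phi>" for \<phi>
  proof -
    have "0 \<le> (L2_norm \<Omega> (grad \<phi>) - 2 * C)\<^sup>2" by simp
    then have "4 * (C * L2_norm \<Omega> (grad \<phi>)) \<le> (L2_norm \<Omega> (grad \<phi>))\<^sup>2 + 4 * C\<^sup>2"
      by (simp add: power2_diff power_mult_distrib algebra_simps)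
    then show ?thesis using coercive[OF that] unfolding E_def by linarith
  qed
  define m0 where "m0 = Inf (E ` {\<phi>. test_function \<Omega> \<phi>})"
  have bdd: "bdd_below (E ` {\<phi>. test_function \<Omega> \<phi>})"
    by (rule bdd_belowI[of _ "- 4 * C\<^sup>2"]) (use below in blast)
  have ne: "E ` {\<phi>. test_function \<Omega> \<phi>} \<noteq> {}" using test_function_zero by blast
  have m0_le: "m0 \<le> E \<phi>" if "test_function \<Omega> \<phi>" for \<phi>
    unfolding m0_def using bdd that by (intro cInf_lower) auto
  have "\<exists>\<phi>. test_function \<Omega> \<phi> \<and> E \<phi> < m0 + inverse (real (Suc n))" for n
  proof -
    have "m0 < m0 + inverse (real (Suc n))" by simp
    then show ?thesis using cInf_less_iff[OF ne bdd] unfolding m0_def by blast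
  qed
  then obtain \<phi> where \<phi>: "\<And>n. test_function \<Omega> (\<phi> n)" and E\<phi>: "\<And>n. E (\<phi> n) < m0 + inverse (real (Suc n))"
    by metis
  \<comment> \<open>The midpoint of two almost minimising functions has energy at least \<open>m0\<close>, so by the parallelogram
    law their gradients are close.\<close>
  have step: "(L2_norm \<Omega> (\<lambda>z. grad (\<phi> i) z - grad (\<phi> j) z))\<^sup>2 \<le> 2 * inverse (real (Suc i)) + 2 * inverse (real (Suc j))" for i j
  proof -
    define \<eta> where "\<eta> = (\<lambda>z. (1/2) * \<phi> i z + (1/2) * \<phi> j z)"
    have \<eta>: "test_function \<Omega> \<eta>" "grad \<eta> = (\<lambda>z. (1/2) *\<^sub>R (grad (\<phi> i) z + grad (\<phi> j) z))"
      using test_function_linear_combination[OF \<phi> \<phi>, where c="1/2" and d="1/2"] unfolding \<eta>_def by (simp_all add: scaleR_add_right)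
    have I\<eta>: "?I \<eta> = (?I (\<phi> i) + ?I (\<phi> j)) / 2"
      unfolding \<eta>_def using int[OF sq(1)[OF \<phi>]] by simp
    have plus: "(L2_norm \<Omega> (\<lambda>z. grad (\<phi> i) z + grad (\<phi> j) z))\<^sup>2 = (L2_norm \<Omega> (grad (\<phi> i)))\<^sup>2
        + 2 * (\<integral>z. grad (\<phi> i) z \<bullet> grad (\<phi> j) z \<partial>lebesgue_on \<Omega>) + (L2_norm \<Omega> (grad (\<phi> j)))\<^sup>2"
      by (rule L2_norm_add_power2[OF sq(2)[OF \<phi>] sq(2)[OF \<phi>]])
    have minus: "(L2_norm \<Omega> (\<lambda>z. grad (\<phi> i) z - grad (\<phi> j) z))\<^sup>2 = (L2_norm \<Omega> (grad (\<phi> i)))\<^sup>2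
        - 2 * (\<integral>z. grad (\<phi> i) z \<bullet> grad (\<phi> j) z \<partial>lebesgue_on \<Omega>) + (L2_norm \<Omega> (grad (\<phi> j)))\<^sup>2"
      using L2_norm_add_power2[OF sq(2)[OF \<phi>[of i]] square_integrable_scale[OF sq(2)[OF \<phi>[of j]], of "-1"]]
        L2_norm_scale[of \<Omega> "-1" "grad (\<phi> j)"] by simp
    have E\<eta>: "4 * E \<eta> = (L2_norm \<Omega> (\<lambda>z. grad (\<phi> i) z + grad (\<phi> j) z))\<^sup>2 - 8 * (?I (\<phi> i) + ?I (\<phi> j))"
      unfolding E_def I\<eta> \<eta>(2) L2_norm_scale by (simp add: power_divide field_simps)
    have "(L2_norm \<Omega> (\<lambda>z. grad (\<phi> i) z - grad (\<phi> j) z))\<^sup>2 = 2 * E (\<phi> i) + 2 * E (\<phi> j) - 4 * E \<eta>"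
      unfolding minus E\<eta> plus by (simp add: E_def algebra_simps)
    then show ?thesis using m0_le[OF \<eta>(1)] E\<phi>[of i] E\<phi>[of j] by linarith
  qed
  have grad_cauchy: "\<exists>N. \<forall>i\<ge>N. \<forall>j\<ge>N. L2_norm \<Omega> (\<lambda>z. grad (\<phi> i) z - grad (\<phi> j) z) < e" if e: "e > 0" for e
  proof -
    obtain N where N: "inverse (real (Suc N)) < e\<^sup>2 / 4" using reals_Archimedean[of "e\<^sup>2 / 4"] e by auto
    have "L2_norm \<Omega> (\<lambda>z. grad (\<phi> i) z - grad (\<phi> j) z) < e" if "i \<ge> N" "j \<ge> N" for i j
    proof (rule power2_less_imp_less)
      have "inverse (real (Suc i)) \<le> inverse (real (Suc N))" "inverse (real (Suc j)) \<le> inverse (real (Suc N))"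
        using that by (simp_all add: le_imp_inverse_le)
      then show "(L2_norm \<Omega> (\<lambda>z. grad (\<phi> i) z - grad (\<phi> j) z))\<^sup>2 < e\<^sup>2"
        using step[of i j] N by linarith
    qed (use e in simp)
    then show ?thesis by blast
  qed
  have \<phi>_cauchy: "\<exists>N. \<forall>i\<ge>N. \<forall>j\<ge>N. L2_norm \<Omega> (\<lambda>z. \<phi> i z - \<phi> j z) < e" if e: "e > 0" for e
  proof -
    obtain N where N: "\<And>i j. i \<ge> N \<Longrightarrow> j \<ge> N \<Longrightarrow> L2_norm \<Omega> (\<lambda>z. grad (\<phi> i) z - grad (\<phi> j) z) < e / (2 * R)"
      using grad_cauchy[of "e / (2 * R)"] e R by (metis divide_pos_pos mult_pos_pos zero_less_numeral)
    have "L2_norm \<Omega> (\<lambda>z. \<phi> i z - \<phi> j z) < e" if "i \<ge> N" "j \<ge> N" for i j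
    proof -
      have "test_function \<Omega> (\<lambda>z. \<phi> i z - \<phi> j z)" "grad (\<lambda>z. \<phi> i z - \<phi> j z) = (\<lambda>z. grad (\<phi> i) z - grad (\<phi> j) z)"
        using test_function_linear_combination[OF \<phi>[of i] \<phi>[of j], where c=1 and d="-1"] by simp_all
      then have "L2_norm \<Omega> (\<lambda>z. \<phi> i z - \<phi> j z) \<le> 2 * R * L2_norm \<Omega> (\<lambda>z. grad (\<phi> i) z - grad (\<phi> j) z)"
        using Poincare_inequality[OF _ s R(1)] by metis
      also have "\<dots> < e" using N[OF that] R(2) by (simp add: field_simps)
      finally show ?thesis .
    qed
    then show ?thesis by blast
  qed
  obtain u where u: "square_integrable \<Omega> u" "(\<lambda>n. L2_norm \<Omega> (\<lambda>z. u z - \<phi> n z)) \<longlonglongrightarrow> 0"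
    by (rule L2_complete[OF m sq(1)[OF \<phi>] \<phi>_cauchy])
  obtain G where G: "square_integrable \<Omega> G" "(\<lambda>n. L2_norm \<Omega> (\<lambda>z. G z - grad (\<phi> n) z)) \<longlonglongrightarrow> 0"
    by (rule L2_complete[OF m sq(2)[OF \<phi>] grad_cauchy])
  have weak: "(\<integral>z. u z *\<^sub>R grad \<psi> z \<partial>lebesgue_on \<Omega>) = - (\<integral>z. \<psi> z *\<^sub>R G z \<partial>lebesgue_on \<Omega>)"
    if \<psi>: "test_function \<Omega> \<psi>" for \<psi>
  proof (rule LIMSEQ_unique)
    show "(\<lambda>n. \<integral>z. \<phi> n z *\<^sub>R grad \<psi> z \<partial>lebesgue_on \<Omega>) \<longlonglongrightarrow> (\<integral>z. u z *\<^sub>R grad \<psi> z \<partial>lebesgue_on \<Omega>)"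
      by (rule L2_scaleR_tendsto[OF u(1) sq(1)[OF \<phi>] sq(2)[OF \<psi>] u(2)])
    have flip: "bounded_bilinear (\<lambda>(a::complex) (b::real). b *\<^sub>R a)"
      by (rule bounded_bilinear.flip[OF bounded_bilinear_scaleR])
    have "(\<lambda>n. \<integral>z. \<psi> z *\<^sub>R grad (\<phi> n) z \<partial>lebesgue_on \<Omega>) \<longlonglongrightarrow> (\<integral>z. \<psi> z *\<^sub>R G z \<partial>lebesgue_on \<Omega>)"
      by (rule L2_bilinear_tendsto[OF flip _ G(1) sq(2)[OF \<phi>] sq(1)[OF \<psi>] G(2)]) simp
    then have "(\<lambda>n. - (\<integral>z. \<psi> z *\<^sub>R grad (\<phi> n) z \<partial>lebesgue_on \<Omega>)) \<longlonglongrightarrow> - (\<integral>z. \<psi> z *\<^sub>R G z \<partial>lebesgue_on \<Omega>)"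
      by (rule tendsto_minus)
    then show "(\<lambda>n. \<integral>z. \<phi> n z *\<^sub>R grad \<psi> z \<partial>lebesgue_on \<Omega>) \<longlonglongrightarrow> - (\<integral>z. \<psi> z *\<^sub>R G z \<partial>lebesgue_on \<Omega>)"
      using test_function_integration_by_parts[OF \<phi> \<psi> s] by simp
  qed
  have W: "sobolev_W12_0 \<Omega> u G"
    using u G \<phi> weak unfolding sobolev_W12_0_def sobolev_W12_def weak_gradient_def by blast
  have "(\<integral>z. G z \<bullet> grad \<psi> z \<partial>lebesgue_on \<Omega>) = 2 * ?I \<psi>" if \<psi>: "test_function \<Omega> \<psi>" for \<psi>
  proof -
    define d where "d n = (\<integral>z. grad (\<phi> n) z \<bullet> grad \<psi> z \<partial>lebesgue_on \<Omega>) - 2 * ?I \<psi>" for n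
    define D where "D = (\<integral>z. G z \<bullet> grad \<psi> z \<partial>lebesgue_on \<Omega>) - 2 * ?I \<psi>"
    have dD: "d \<longlonglongrightarrow> D"
      unfolding d_def D_def
      by (intro tendsto_diff tendsto_const L2_inner_tendsto[OF G(1) sq(2)[OF \<phi>] sq(2)[OF \<psi>] G(2)])
    have var: "0 \<le> 2 * t * D + t\<^sup>2 * (L2_norm \<Omega> (grad \<psi>))\<^sup>2" for t
    proof -
      have "0 \<le> 2 * t * d n + t\<^sup>2 * (L2_norm \<Omega> (grad \<psi>))\<^sup>2 + inverse (real (Suc n))" for n
      proof -
        define \<eta> where "\<eta> = (\<lambda>z. 1 * \<phi> n z + t * \<psi> z)"
        have \<eta>: "test_function \<Omega> \<eta>" "grad \<eta> = (\<lambda>z. grad (\<phi> n) z + t *\<^sub>R grad \<psi> z)"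
          using test_function_linear_combination[OF \<phi> \<psi>, where c=1 and d=t] unfolding \<eta>_def by simp_all
        have I\<eta>: "?I \<eta> = ?I (\<phi> n) + t * ?I \<psi>"
          unfolding \<eta>_def using int[OF sq(1)[OF \<phi>]] int[OF sq(1)[OF \<psi>]] by simp
        have "(L2_norm \<Omega> (grad \<eta>))\<^sup>2 = (L2_norm \<Omega> (grad (\<phi> n)))\<^sup>2
            + 2 * (t * (\<integral>z. grad (\<phi> n) z \<bullet> grad \<psi> z \<partial>lebesgue_on \<Omega>)) + t\<^sup>2 * (L2_norm \<Omega> (grad \<psi>))\<^sup>2"
          unfolding \<eta>(2) L2_norm_add_power2[OF sq(2)[OF \<phi>] square_integrable_scale[OF sq(2)[OF \<psi>]]]
          by (simp add: L2_norm_scale power_mult_distrib)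
        then have "E \<eta> = E (\<phi> n) + 2 * t * d n + t\<^sup>2 * (L2_norm \<Omega> (grad \<psi>))\<^sup>2"
          unfolding E_def I\<eta> d_def by (simp add: algebra_simps)
        then show ?thesis using m0_le[OF \<eta>(1)] E\<phi>[of n] by linarith
      qed
      moreover have "(\<lambda>n. 2 * t * d n + t\<^sup>2 * (L2_norm \<Omega> (grad \<psi>))\<^sup>2 + inverse (real (Suc n)))
          \<longlonglongrightarrow> 2 * t * D + t\<^sup>2 * (L2_norm \<Omega> (grad \<psi>))\<^sup>2 + 0"
        by (intro tendsto_intros dD LIMSEQ_inverse_real_of_nat)
      ultimately show ?thesis by (intro LIMSEQ_le_const[where a=0]) (auto intro!: exI[of _ 0])
    qed
    have "D = 0"
    proof (rule ccontr)
      assume "D \<noteq> 0"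
      define L where "L = (L2_norm \<Omega> (grad \<psi>))\<^sup>2"
      have L: "L \<ge> 0" by (simp add: L_def)
      \<comment> \<open>The minimising parameter is \<open>- D / L\<close>; adding \<open>1\<close> covers the case \<open>L = 0\<close>.\<close>
      have "0 \<le> 2 * (- D / (L + 1)) * D + (- D / (L + 1))\<^sup>2 * L"
        unfolding L_def by (rule var)
      also have "\<dots> = - (D\<^sup>2 * (L + 2)) / (L + 1)\<^sup>2"
        using L by (simp add: power_divide divide_simps) (simp add: power2_eq_square algebra_simps)
      also have "\<dots> < 0" using L \<open>D \<noteq> 0\<close> by (simp add: divide_simps)
      finally show False by simp
    qed
    then show ?thesis by (simp add: D_def)
  qed
  then show ?thesis using W unfolding stress_function_def by blast
qed

text \<open>The weak equation for \<open>u\<close>, tested with \<open>v\<close>; this is legitimate since \<open>v\<close> and its gradient are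
  limits of test functions. The left-hand side is symmetric, so all stress functions have the same mean.\<close>

lemma stress_function_pairing:
  assumes \<Omega>: "\<Omega> \<in> lmeasurable" and uG: "stress_function \<Omega> u G" and vH: "stress_function \<Omega> v H"
  shows "(\<integral>z. G z \<bullet> H z \<partial>lebesgue_on \<Omega>) = 2 * (\<integral>z. v z \<partial>lebesgue_on \<Omega>)"
proof -
  have s: "\<Omega> \<in> sets lebesgue" using \<Omega> by blast
  note sq = test_function_square_integrable[OF _ s]
  obtain \<phi> where \<phi>: "\<And>n. test_function \<Omega> (\<phi> n)" and lim: "(\<lambda>n. L2_norm \<Omega> (\<lambda>z. v z - \<phi> n z)) \<longlonglongrightarrow> 0"
       "(\<lambda>n. L2_norm \<Omega> (\<lambda>z. H z - grad (\<phi> n) z)) \<longlonglongrightarrow> 0"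
    using vH unfolding stress_function_def sobolev_W12_0_def by blast
  have S: "square_integrable \<Omega> G" "square_integrable \<Omega> H" "square_integrable \<Omega> v"
    using uG vH unfolding stress_function_def sobolev_W12_0_def sobolev_W12_def by auto
  have eq: "(\<integral>z. G z \<bullet> grad (\<phi> n) z \<partial>lebesgue_on \<Omega>) = 2 * (\<integral>z. \<phi> n z \<partial>lebesgue_on \<Omega>)" for n
    using uG \<phi> unfolding stress_function_def by blast
  show ?thesis
  proof (rule LIMSEQ_unique)
    show "(\<lambda>n. \<integral>z. G z \<bullet> grad (\<phi> n) z \<partial>lebesgue_on \<Omega>) \<longlonglongrightarrow> (\<integral>z. G z \<bullet> H z \<partial>lebesgue_on \<Omega>)"
      using L2_inner_tendsto[OF S(2) sq(2)[OF \<phi>] S(1) lim(2)] by (simp add: inner_commute)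
    show "(\<lambda>n. \<integral>z. G z \<bullet> grad (\<phi> n) z \<partial>lebesgue_on \<Omega>) \<longlonglongrightarrow> 2 * (\<integral>z. v z \<partial>lebesgue_on \<Omega>)"
      unfolding eq
      using L2_inner_tendsto[OF S(3) sq(1)[OF \<phi>] square_integrable_const[OF \<Omega>, of 1] lim(1)]
      by (intro tendsto_mult_left) simp
  qed
qed

lemma stress_function_mean_bound:
  assumes \<Omega>: "\<Omega> \<in> lmeasurable" and uG: "stress_function \<Omega> u G"
    and coercive: "\<And>\<phi>. test_function \<Omega> \<phi> \<Longrightarrow> \<bar>\<integral>z. \<phi> z \<partial>lebesgue_on \<Omega>\<bar> \<le> C * L2_norm \<Omega> (grad \<phi>)"
  shows "\<bar>\<integral>z. u z \<partial>lebesgue_on \<Omega>\<bar> \<le> C * L2_norm \<Omega> G"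
proof -
  have s: "\<Omega> \<in> sets lebesgue" using \<Omega> by blast
  note sq = test_function_square_integrable[OF _ s]
  obtain \<phi> where \<phi>: "\<And>n. test_function \<Omega> (\<phi> n)" and lim: "(\<lambda>n. L2_norm \<Omega> (\<lambda>z. u z - \<phi> n z)) \<longlonglongrightarrow> 0"
       "(\<lambda>n. L2_norm \<Omega> (\<lambda>z. G z - grad (\<phi> n) z)) \<longlonglongrightarrow> 0"
    using uG unfolding stress_function_def sobolev_W12_0_def by blast
  have S: "square_integrable \<Omega> G" "square_integrable \<Omega> u"
    using uG unfolding stress_function_def sobolev_W12_0_def sobolev_W12_def by auto
  have "(\<lambda>n. \<bar>\<integral>z. \<phi> n z \<partial>lebesgue_on \<Omega>\<bar>) \<longlonglongrightarrow> \<bar>\<integral>z. u z \<partial>lebesgue_on \<Omega>\<bar>"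
    using L2_inner_tendsto[OF S(2) sq(1)[OF \<phi>] square_integrable_const[OF \<Omega>, of 1] lim(1)]
    by (intro tendsto_rabs) simp
  moreover have "(\<lambda>n. C * L2_norm \<Omega> (grad (\<phi> n))) \<longlonglongrightarrow> C * L2_norm \<Omega> G"
    by (intro tendsto_mult_left L2_norm_tendsto[OF S(1) sq(2)[OF \<phi>] lim(2)])
  ultimately show ?thesis
    by (rule LIMSEQ_le) (use coercive \<phi> in blast)
qed

text \<open>By \<open>stress_function_pairing\<close> the quotient in the definition of \<open>torsional_rigidity\<close> is the \<open>L\<^sup>2\<close>
  norm of the gradient for every solution, and this norm is the same for all of them. If the gradient
  vanishes, the quotient is \<open>0 / 0 = 0\<close>, in accordance with the formula.\<close>

lemma torsional_rigidity_eq: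
  assumes \<Omega>: "\<Omega> \<in> lmeasurable" and uG: "stress_function \<Omega> u G"
  shows "torsional_rigidity \<Omega> = (L2_norm \<Omega> G)\<^sup>2"
proof -
  have self: "2 * \<bar>\<integral>z. v z \<partial>lebesgue_on \<Omega>\<bar> / L2_norm \<Omega> H = L2_norm \<Omega> H" if "stress_function \<Omega> v H" for v H
  proof -
    have "(L2_norm \<Omega> H)\<^sup>2 = 2 * (\<integral>z. v z \<partial>lebesgue_on \<Omega>)"
      using stress_function_pairing[OF \<Omega> that that] by (simp add: L2_norm_eq_inner)
    then have "2 * \<bar>\<integral>z. v z \<partial>lebesgue_on \<Omega>\<bar> = (L2_norm \<Omega> H)\<^sup>2"
      by (metis abs_mult abs_numeral abs_power2)
    then show ?thesis by (simp add: power2_eq_square)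
  qed
  have unique: "L2_norm \<Omega> H = L2_norm \<Omega> G" if vH: "stress_function \<Omega> v H" for v H
  proof -
    have "(L2_norm \<Omega> H)\<^sup>2 = 2 * (\<integral>z. v z \<partial>lebesgue_on \<Omega>)"
      using stress_function_pairing[OF \<Omega> vH vH] by (simp add: L2_norm_eq_inner)
    also have "\<dots> = (\<integral>z. H z \<bullet> G z \<partial>lebesgue_on \<Omega>)"
      using stress_function_pairing[OF \<Omega> uG vH] by (simp add: inner_commute)
    also have "\<dots> = (L2_norm \<Omega> G)\<^sup>2"
      using stress_function_pairing[OF \<Omega> vH uG] stress_function_pairing[OF \<Omega> uG uG] by (simp add: L2_norm_eq_inner)
    finally show ?thesis using L2_norm_nonneg by (metis power2_eq_iff_nonneg)
  qed
  show ?thesis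
    unfolding torsional_rigidity_def
  proof (rule the_equality)
    show "\<exists>v H. stress_function \<Omega> v H \<and> 0 \<le> (L2_norm \<Omega> G)\<^sup>2 \<and>
        sqrt ((L2_norm \<Omega> G)\<^sup>2) = 2 * \<bar>\<integral>z. v z \<partial>lebesgue_on \<Omega>\<bar> / L2_norm \<Omega> H"
      using uG self[OF uG] L2_norm_nonneg[of \<Omega> G] by (intro exI[of _ u] exI[of _ G]) simp
    fix \<rho>
    assume "\<exists>v H. stress_function \<Omega> v H \<and> 0 \<le> \<rho> \<and> sqrt \<rho> = 2 * \<bar>\<integral>z. v z \<partial>lebesgue_on \<Omega>\<bar> / L2_norm \<Omega> H"
    then obtain v H where vH: "stress_function \<Omega> v H" "0 \<le> \<rho>" "sqrt \<rho> = 2 * \<bar>\<integral>z. v z \<partial>lebesgue_on \<Omega>\<bar> / L2_norm \<Omega> H"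
      by blast
    then have "sqrt \<rho> = L2_norm \<Omega> G" using self unique by metis
    then show "\<rho> = (L2_norm \<Omega> G)\<^sup>2" using vH(2) by (metis real_sqrt_pow2)
  qed
qed

section \<open>The isoperimetric bound for torsional rigidity\<close>

theorem corollary7:
  fixes \<Omega> :: "complex set"
  assumes "open \<Omega>" and "connected \<Omega>" and "\<Omega> \<noteq> {}"
    and "bounded \<Omega>" and "simply_connected \<Omega>"
  shows "torsional_rigidity \<Omega> \<le> (measure lebesgue \<Omega>)\<^sup>2 / (2 * pi)"
proof -
  define C where "C = measure lebesgue \<Omega> / sqrt (8 * pi)"
  have bound: "\<bar>\<integral>z. \<phi> z \<partial>lebesgue_on \<Omega>\<bar> \<le> C * L2_norm \<Omega> (grad \<phi>)" if "test_function \<Omega> \<phi>" for \<phi>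
    unfolding C_def using assms that by (intro test_function_mean_bound)
  have m: "\<Omega> \<in> lmeasurable" using assms by (simp add: lmeasurable_open)
  obtain u G where uG: "stress_function \<Omega> u G"
    using stress_function_exists[OF assms(1,4) bound] by blast
  have "(L2_norm \<Omega> G)\<^sup>2 = 2 * (\<integral>z. u z \<partial>lebesgue_on \<Omega>)"
    using stress_function_pairing[OF m uG uG] by (simp add: L2_norm_eq_inner)
  also have "\<dots> \<le> 2 * (C * L2_norm \<Omega> G)"
    using stress_function_mean_bound[OF m uG bound] by linarith
  finally have "L2_norm \<Omega> G * L2_norm \<Omega> G \<le> (2 * C) * L2_norm \<Omega> G" by (simp add: power2_eq_square)
  moreover have "0 \<le> C" by (simp add: C_def)
  ultimately have "L2_norm \<Omega> G \<le> 2 * C"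
    using L2_norm_nonneg[of \<Omega> G] by (cases "L2_norm \<Omega> G = 0") auto
  then have "(L2_norm \<Omega> G)\<^sup>2 \<le> (2 * C)\<^sup>2"
    by (rule power_mono) (rule L2_norm_nonneg)
  also have "\<dots> = (measure lebesgue \<Omega>)\<^sup>2 / (2 * pi)"
    by (simp add: C_def power_divide power_mult_distrib)
  finally show ?thesis by (simp add: torsional_rigidity_eq[OF m uG])
qed

end
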